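(* Let $m$ and $n$ be integers with $0\le m\le n$, and let $\mu,\nu$ be partitions with $l(\mu)+l(\nu)\le n+m$, so that $\lambda=\mu\bar\nu$ is a dominant weight of $U(n+m)$. Then $$\frac1Z\int_T P_{\mu\bar\nu}(x_1,\dots,x_m,y_1,\dots,y_n;t)\,\frac{1}{n!\,m!}\prod_{1\le i\ne j\le m}\frac{1-x_ix_j^{-1}}{1-tx_ix_j^{-1}}\prod_{1\le i\ne j\le n}\frac{1-y_iy_j^{-1}}{1-ty_iy_j^{-1}}\,dT=0$$ unless $\mu=\nu$ and $l(\mu)\le m$, in which case the left-hand side equals $$\frac{C^0_\mu(t^n,t^m;0,t)}{C^-_\mu(t;0,t)\,C^+_\mu(t^{m+n-2}t;0,t)}.$$ Here the normalization $Z$ is the integral (without the factor $1/Z$) for $\mu=\nu=0$.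
   Context: Let $t\in\mathbb{C}$ with $|t|<1$. $T$ is the torus on which all of the variables $x_i,y_j$ have absolute value $1$, and $dT=\prod_i\frac{dx_i}{2\pi\sqrt{-1}\,x_i}\prod_j\frac{dy_j}{2\pi\sqrt{-1}\,y_j}$. $l(\mu)$ is the number of nonzero parts of $\mu$. For partitions $\mu,\nu$ with $l(\mu)+l(\nu)\le N$, $\mu\bar\nu$ denotes the vector $(\mu_1,\dots,\mu_{l(\mu)},0,\dots,0,-\nu_{l(\nu)},\dots,-\nu_1)$ with $N$ entries (here $N=n+m$). $[i]=(1-t^i)/(1-t)$, $[k]!=[k]\cdots[1]$, $[0]!=1$. For a weakly decreasing integer vector $\lambda$ with $N$ entries, $m_i(\lambda)$ is the number of entries equal to $i$ ($i\in\mathbb{Z}$), $v_\lambda(t)=\prod_{i\in\mathbb{Z}}[m_i(\lambda)]!$, and the Hall--Littlewood polynomial is $P_\lambda(z_1,\dots,z_N;t)=\frac{1}{v_\lambda(t)}\sum_{w\in S_N}w\Big(z^\lambda\prod_{1\le i<j\le N}\frac{z_i-tz_j}{z_i-z_j}\Big)$, with $w$ permuting the subscripts of the variables. The $C$-symbols at $q=0$, for a partition $\mu$, are: $C^0_\mu(x;0,t)=\prod_{1\le i\le l(\mu)}(1-t^{1-i}x)$, with $C^0_\mu(a,b;0,t)=C^0_\mu(a;0,t)\,C^0_\mu(b;0,t)$; $C^-_\mu(t;0,t)=(1-t)^{l(\mu)}\prod_{i\ge1}[m_i(\mu)]!$; and $C^+_\mu(x;0,t)=1$. *)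

theory Defs
  imports "HOL-Analysis.Analysis" "HOL-Combinatorics.Permutations"
begin

(* A partition is the list of its nonzero parts, so that l(\<mu>) is length \<mu> and equality of
   partitions is equality of lists; the zero partition is []. *)
definition is_partition :: "nat list \<Rightarrow> bool" where
  "is_partition \<mu> \<longleftrightarrow> sorted_wrt (\<ge>) \<mu> \<and> (\<forall>k\<in>set \<mu>. 0 < k)"

(* The vector \<mu>\<nu>-bar with N entries; it has this length when length \<mu> + length \<nu> \<le> N. *)
definition bar_weight :: "nat \<Rightarrow> nat list \<Rightarrow> nat list \<Rightarrow> int list" where
  "bar_weight N \<mu> \<nu> =
     map int \<mu> @ replicate (N - (length \<mu> + length \<nu>)) 0 @ rev (map (\<lambda>k. - int k) \<nu>)"

definition qnum :: "complex \<Rightarrow> nat \<Rightarrow> complex" where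
  "qnum t i = (1 - t ^ i) / (1 - t)"

definition qfact :: "complex \<Rightarrow> nat \<Rightarrow> complex" where
  "qfact t k = (\<Prod>i=1..k. qnum t i)"

(* Integers that do not occur in lam would only contribute the factor [0]! = 1. *)
definition HL_v :: "complex \<Rightarrow> int list \<Rightarrow> complex" where
  "HL_v t lam = (\<Prod>i\<in>set lam. qfact t (count_list lam i))"

definition HL_summand :: "complex \<Rightarrow> int list \<Rightarrow> (nat \<Rightarrow> complex) \<Rightarrow> complex" where
  "HL_summand t lam z =
     (\<Prod>i<length lam. z i powi (lam ! i)) *
     (\<Prod>j<length lam. \<Prod>i<j. (z i - t * z j) / (z i - z j))"

(* The variables are z 0, ..., z (N - 1) with N = length lam. The formula is evaluated pointwise, so
   it agrees with the Hall-Littlewood Laurent polynomial where the variables are nonzero and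
   pairwise distinct, hence almost everywhere on the torus; on the diagonals z i = z j the
   convention x / 0 = 0 gives other values. *)
definition hall_littlewood :: "complex \<Rightarrow> int list \<Rightarrow> (nat \<Rightarrow> complex) \<Rightarrow> complex" where
  "hall_littlewood t lam z =
     1 / HL_v t lam * (\<Sum>w | w permutes {..<length lam}. HL_summand t lam (z \<circ> w))"

(* dx / (2 pi i x) on the unit circle, through x = exp (2 pi i \<theta>) with 0 \<le> \<theta> \<le> 1. *)
definition circle_measure :: "complex measure" where
  "circle_measure = distr (uniform_measure lborel {0..1::real}) borel (\<lambda>\<theta>. cis (2 * pi * \<theta>))"

definition torus_measure :: "nat \<Rightarrow> (nat \<Rightarrow> complex) measure" where
  "torus_measure N = PiM {..<N} (\<lambda>_. circle_measure)"

definition torus_weight :: "complex \<Rightarrow> nat set \<Rightarrow> (nat \<Rightarrow> complex) \<Rightarrow> complex" where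
  "torus_weight t I z =
     (\<Prod>i\<in>I. \<Prod>j\<in>I - {i}. (1 - z i * inverse (z j)) / (1 - t * z i * inverse (z j)))"

(* The unnormalized integral. The m + n variables form one vector z: x_1, ..., x_m are the entries
   z 0, ..., z (m - 1), and y_1, ..., y_n are z m, ..., z (m + n - 1). *)
definition HL_integral :: "complex \<Rightarrow> nat \<Rightarrow> nat \<Rightarrow> nat list \<Rightarrow> nat list \<Rightarrow> complex" where
  "HL_integral t m n \<mu> \<nu> =
     (LINT z|torus_measure (m + n).
        hall_littlewood t (bar_weight (m + n) \<mu> \<nu>) z * (1 / (fact n * fact m)) *
        torus_weight t {..<m} z * torus_weight t {m..<m + n} z)"

(* The C-symbols at q = 0. In C0, for t = 0 and i > 1 the factor t powi (1 - i) is 0; with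
   x = t ^ n and length \<mu> \<le> n this gives the same value as reading t^(1-i) t^n as t^(n+1-i). *)
definition C0 :: "nat list \<Rightarrow> complex \<Rightarrow> complex \<Rightarrow> complex" where
  "C0 \<mu> x t = (\<Prod>i=1..length \<mu>. 1 - t powi (1 - int i) * x)"

definition C0_pair :: "nat list \<Rightarrow> complex \<Rightarrow> complex \<Rightarrow> complex \<Rightarrow> complex" where
  "C0_pair \<mu> a b t = C0 \<mu> a t * C0 \<mu> b t"

(* Only the specialization C^-_\<mu>(t; 0, t), with first argument equal to t. *)
definition Cminus :: "nat list \<Rightarrow> complex \<Rightarrow> complex" where
  "Cminus \<mu> t = (1 - t) ^ length \<mu> * (\<Prod>i\<in>set \<mu>. qfact t (count_list \<mu> i))"

definition Cplus :: "nat list \<Rightarrow> complex \<Rightarrow> complex \<Rightarrow> complex" where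
  "Cplus \<mu> x t = 1"

end

theory Submission
  imports Defs "HOL-Complex_Analysis.Cauchy_Integral_Formula" "HOL-Real_Asymp.Real_Asymp"
    "HOL-Combinatorics.Multiset_Permutations" "HOL-Probability.Infinite_Product_Measure"
begin

text \<open>
  Up to constants, the integral is that of the symmetrized sum \<open>v\<^sub>\<lambda> P\<^sub>\<lambda>\<close>, the sum over all orders of the
  variables of \<open>z\<^sup>\<lambda>\<close> times the factors \<open>(z\<^sub>i - t z\<^sub>j) / (z\<^sub>i - z\<^sub>j)\<close>. The idea is to integrate this sum order
  by order, which produces a recursion that strips the first and the last entry of \<open>\<lambda>\<close>.

  Suppose that the first exponent \<open>k\<close> is positive and at least as large as the absolute value of the last one, and move
  the variables \<open>x\<close> to a circle of radius \<open>r < 1\<close>. Consider which variable stands first. If it is some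
  \<open>x\<^sub>a\<close>, the integrand is holomorphic in \<open>x\<^sub>a\<close> inside the circle and vanishes at 0, so the contribution is zero
  (\<open>integral_lead_x\<close>). If it is some \<open>y\<^sub>a\<close>, the only poles in \<open>y\<^sub>a\<close> inside the unit circle are the points \<open>x\<^sub>c\<close>
  (\<open>integral_lead_y\<close>). At such a pole \<open>x\<^sub>c\<close> inherits the exponent \<open>k\<close> and the weight factors of \<open>y\<^sub>a\<close>, and
  these cancel all the poles in \<open>x\<^sub>c\<close> that are not outside the circle. The integral over \<open>x\<^sub>c\<close> is therefore the value at
  \<open>x\<^sub>c = 0\<close>, which vanishes unless the last exponent is exactly \<open>-k\<close>; in that case the orders in which
  \<open>x\<^sub>c\<close> occupies one of the \<open>M\<close> positions with exponent \<open>-k\<close> add up to \<open>1 + t + \<dots> + t\<^bsup>M-1\<^esup>\<close>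
  (\<open>integral_pair_term\<close>, \<open>hl_res_0\<close>). Altogether the integral for \<open>\<lambda>\<close> is \<open>(1 - t) [M]\<close> times the sum over all
  pairs \<open>(a, c)\<close> of the integrals for the shortened weight without the variables \<open>y\<^sub>a\<close> and \<open>x\<^sub>c\<close>
  (\<open>hl_int_recursion\<close>).

  Three facts complete the argument. First, the symmetrized sum is a Laurent polynomial and hence bounded,
  so \<open>r\<close> may tend to 1 by dominated convergence (\<open>hl_sum_bounded\<close>, \<open>hl_int_1_recursion\<close>). Second, complex
  conjugation exchanges the two partitions, so a weight whose last exponent dominates gives zero
  as well (\<open>hl_int_cnj\<close>). Third, the total mass of the weight, which gives the constant for the zero weight, follows by
  removing one variable at a time (\<open>weight_int_value\<close>). Induction on the first partition then evaluates the
  integral (\<open>hl_int_value\<close>): it vanishes unless the partitions agree and the parts do not outnumber a block.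
\<close>

section \<open>The symmetrized sum as a recursion over finite index sets\<close>

text \<open>The factor of the Hall-Littlewood summand for a variable \<open>a\<close> standing before a variable \<open>b\<close>.\<close>
definition cross :: "complex \<Rightarrow> complex \<Rightarrow> complex \<Rightarrow> complex" where
  "cross t a b = (a - t * b) / (a - b)"

text \<open>The symmetrized sum \<open>v\<^sub>\<lambda> P\<^sub>\<lambda>\<close> in the variables with indices in \<open>A\<close>, organized by which variable
  \<open>a\<close> stands first and hence carries the first exponent. Working with arbitrary finite index sets
  allows variables to be integrated out one at a time without renumbering the others. Only the
  case \<open>card A = length ks\<close> has this meaning.\<close>
fun hl_sum :: "complex \<Rightarrow> int list \<Rightarrow> nat set \<Rightarrow> (nat \<Rightarrow> complex) \<Rightarrow> complex" where
  "hl_sum t [] A z = 1"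
| "hl_sum t (k # ks) A z =
     (\<Sum>a\<in>A. z a powi k * (\<Prod>b\<in>A - {a}. cross t (z a) (z b)) * hl_sum t ks (A - {a}) z)"

lemma hl_sum_cong:
  "(\<And>i. i \<in> A \<Longrightarrow> z i = z' i) \<Longrightarrow> hl_sum t ks A z = hl_sum t ks A z'"
proof (induction ks arbitrary: A)
  case (Cons k ks)
  have "(\<Prod>b\<in>A - {a}. cross t (z a) (z b)) = (\<Prod>b\<in>A - {a}. cross t (z' a) (z' b))" if "a \<in> A" for a
    using Cons.prems that by (intro prod.cong) auto
  moreover have "hl_sum t ks (A - {a}) z = hl_sum t ks (A - {a}) z'" for a
    using Cons.prems by (intro Cons.IH) auto
  ultimately show ?case
    using Cons.prems by (simp cong: sum.cong)
qed simp

lemma hl_sum_image: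
  "inj_on p A \<Longrightarrow> hl_sum t ks (p ` A) z = hl_sum t ks A (z \<circ> p)"
proof (induction ks arbitrary: A)
  case (Cons k ks)
  have "p ` A - {p a} = p ` (A - {a})" if "a \<in> A" for a
    using Cons.prems that by (auto simp: inj_on_def)
  moreover have "inj_on p (A - {a})" for a
    using Cons.prems by (rule inj_on_subset) auto
  ultimately show ?case
    using Cons by (simp add: sum.reindex prod.reindex cong: sum.cong)
qed simp

text \<open>One summand of \<^const>\<open>hl_sum\<close>, for the variables written in a fixed order. It links the recursion
  on sets with the sum over permutations, and it shows what reversing the order does.\<close>
primrec word_term :: "complex \<Rightarrow> int list \<Rightarrow> complex list \<Rightarrow> complex" where
  "word_term t [] xs = 1"
| "word_term t (k # ks) xs =
     hd xs powi k * (\<Prod>y\<leftarrow>tl xs. cross t (hd xs) y) * word_term t ks (tl xs)"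

lemma hl_sum_words:
  assumes "finite A" "card A = length ks"
  shows "hl_sum t ks A z = (\<Sum>xs\<in>permutations_of_set A. word_term t ks (map z xs))"
  using assms
proof (induction ks arbitrary: A)
  case Nil
  then show ?case by simp
next
  case (Cons k ks)
  have inj_on_Cons: "inj_on ((#) a) S" for a :: nat and S
    by (simp add: inj_on_def)
  have ne: "A \<noteq> {}" using Cons.prems by auto
  have list: "(\<Prod>y\<leftarrow>map z xs. cross t (z a) y) = (\<Prod>b\<in>A - {a}. cross t (z a) (z b))"
    if "xs \<in> permutations_of_set (A - {a})" for a xs
    using that by (simp add: permutations_of_set_def o_def prod.distinct_set_conv_list[symmetric])
  have "(\<Sum>xs\<in>permutations_of_set A. word_term t (k # ks) (map z xs)) =
    (\<Sum>a\<in>A. \<Sum>xs\<in>(#) a ` permutations_of_set (A - {a}). word_term t (k # ks) (map z xs))"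
    unfolding permutations_of_set_nonempty[OF ne]
    using Cons.prems by (intro sum.UNION_disjoint) auto
  also have "\<dots> = (\<Sum>a\<in>A. \<Sum>xs\<in>permutations_of_set (A - {a}).
      z a powi k * (\<Prod>b\<in>A - {a}. cross t (z a) (z b)) * word_term t ks (map z xs))"
  proof (rule sum.cong[OF refl], unfold sum.reindex[OF inj_on_Cons] o_def, rule sum.cong[OF refl])
    fix a xs assume "a \<in> A" "xs \<in> permutations_of_set (A - {a})"
    then show "word_term t (k # ks) (map z (a # xs)) =
        z a powi k * (\<Prod>b\<in>A - {a}. cross t (z a) (z b)) * word_term t ks (map z xs)"
      using list[of xs a] by simp
  qed
  also have "\<dots> = hl_sum t (k # ks) A z"
    using Cons by (simp add: sum_distrib_left[symmetric])
  finally show ?case by simp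
qed

lemma HL_summand_Cons:
  "HL_summand t (k # ks) z =
     z 0 powi k * (\<Prod>j<length ks. cross t (z 0) (z (Suc j))) * HL_summand t ks (\<lambda>i. z (Suc i))"
proof -
  have *: "HL_summand t ls z =
      (\<Prod>i<length ls. z i powi (ls ! i)) * (\<Prod>j<length ls. \<Prod>i<j. cross t (z i) (z j))" for ls z
    by (simp add: HL_summand_def cross_def)
  show ?thesis
    unfolding * by (simp add: prod.lessThan_Suc_shift prod.distrib o_def del: prod.lessThan_Suc)
qed

lemma prod_list_nth: "(\<Prod>y\<leftarrow>ys. f y) = (\<Prod>j<length ys. f (ys ! j :: 'a) :: complex)"
  by (induction ys) (simp_all add: prod.lessThan_Suc_shift del: prod.lessThan_Suc)

lemma HL_summand_word:
  "length xs = length ks \<Longrightarrow> HL_summand t ks (\<lambda>i. xs ! i) = word_term t ks xs"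
proof (induction ks arbitrary: xs)
  case (Cons k ks)
  then obtain x ys where "xs = x # ys" "length ys = length ks" by (cases xs) auto
  moreover have "(\<Prod>y\<leftarrow>ys. cross t x y) = (\<Prod>j<length ys. cross t x (ys ! j))"
    by (simp add: prod_list_nth)
  ultimately show ?case
    using Cons.IH[of ys] by (simp add: HL_summand_Cons)
qed (simp add: HL_summand_def)

lemma HL_summand_cong:
  "(\<And>i. i < length ks \<Longrightarrow> z i = z' i) \<Longrightarrow> HL_summand t ks z = HL_summand t ks z'"
  unfolding HL_summand_def by (intro arg_cong2[of _ _ _ _ "(*)"] prod.cong) auto

lemma sum_permutes_words:
  fixes f :: "nat list \<Rightarrow> complex"
  shows "(\<Sum>w | w permutes {..<n}. f (map w [0..<n])) = (\<Sum>xs\<in>permutations_of_set {..<n}. f xs)"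
proof (rule sum.reindex_bij_betw)
  have *: "map w [0..<n] = map w' [0..<n] \<Longrightarrow> w = w'"
    if "w permutes {..<n}" "w' permutes {..<n}" for w w'
    using that by (intro ext) (metis atLeast0LessThan lessThan_iff map_eq_conv permutes_not_in set_upt)
  show "bij_betw (\<lambda>w. map w [0..<n]) {w. w permutes {..<n}} (permutations_of_set {..<n})"
    unfolding bij_betw_def
  proof (intro conjI inj_onI card_subset_eq)
    show "(\<lambda>w. map w [0..<n]) ` {w. w permutes {..<n}} \<subseteq> permutations_of_set {..<n}"
      by (auto simp: permutations_of_set_def distinct_map permutes_inj_on permutes_image atLeast0LessThan)
    show "card ((\<lambda>w. map w [0..<n]) ` {w. w permutes {..<n}}) = card (permutations_of_set {..<n})"
      using * by (subst card_image) (auto simp: inj_on_def card_permutations)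
  qed (use * in auto)
qed

lemma sum_permutes_hl_sum:
  "(\<Sum>w | w permutes {..<length ks}. HL_summand t ks (z \<circ> w)) = hl_sum t ks {..<length ks} z"
proof -
  have "HL_summand t ks (z \<circ> w) = word_term t ks (map z (map w [0..<length ks]))" for w
    by (subst HL_summand_word[symmetric], simp, intro HL_summand_cong) simp
  then show ?thesis
    using sum_permutes_words[of "\<lambda>xs. word_term t ks (map z xs)" "length ks"]
    by (simp add: hl_sum_words)
qed

section \<open>A partial fraction expansion\<close>

text \<open>As a function of \<open>y\<close> the product has simple poles at the distinct points \<open>z a\<close> and tends to 1 at
  infinity, so it is determined by its residues. The expansion serves twice: at \<open>y = 0\<close> it sums the
  factors of a first variable, and on the torus it isolates the poles that contribute to an integral.\<close>
lemma lagrange_expansion: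
  fixes z :: "nat \<Rightarrow> complex"
  assumes "finite A" "inj_on z A" "y \<notin> z ` A"
  shows "(\<Prod>b\<in>A. cross t y (z b)) =
    1 + (1 - t) * (\<Sum>a\<in>A. z a * (\<Prod>b\<in>A - {a}. cross t (z a) (z b)) / (y - z a))"
  using assms
proof (induction A arbitrary: y rule: finite_induct)
  case empty
  then show ?case by simp
next
  case (insert c A)
  let ?P = "\<lambda>a. \<Prod>b\<in>A - {a}. cross t (z a) (z b)"
  have nz: "y - z c \<noteq> 0" "\<And>a. a \<in> A \<Longrightarrow> y - z a \<noteq> 0" "\<And>a. a \<in> A \<Longrightarrow> z a - z c \<noteq> 0"
    "\<And>a. a \<in> A \<Longrightarrow> z c - z a \<noteq> 0"
    using insert by (auto simp: inj_on_def)
  have IH: "(\<Prod>b\<in>A. cross t y (z b)) = 1 + (1 - t) * (\<Sum>a\<in>A. z a * ?P a / (y - z a))"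
    "(\<Prod>b\<in>A. cross t (z c) (z b)) = 1 + (1 - t) * (\<Sum>a\<in>A. z a * ?P a / (z c - z a))"
    using insert by (auto simp: inj_on_def)
  have split: "(\<Prod>b\<in>insert c A - {a}. cross t (z a) (z b)) = cross t (z a) (z c) * ?P a" if "a \<in> A" for a
  proof -
    have "insert c A - {a} = insert c (A - {a})" using insert that by auto
    then show ?thesis using insert by simp
  qed
  have pf: "cross t y (z c) * (p / (y - z a)) =
      cross t (z a) (z c) * p / (y - z a) + (1 - t) * z c / (y - z c) * (p / (z c - z a))"
    if "a \<in> A" for a p
    using nz(1) nz(2-4)[OF that] unfolding cross_def by (simp add: divide_simps) (simp add: algebra_simps)
  have "(\<Prod>b\<in>insert c A. cross t y (z b)) =
      cross t y (z c) + (1 - t) * (\<Sum>a\<in>A. cross t y (z c) * (z a * ?P a / (y - z a)))"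
    using insert by (simp add: IH(1) algebra_simps sum_distrib_left)
  also have "(\<Sum>a\<in>A. cross t y (z c) * (z a * ?P a / (y - z a))) =
      (\<Sum>a\<in>A. z a * (cross t (z a) (z c) * ?P a) / (y - z a)) +
      (1 - t) * z c / (y - z c) * (\<Sum>a\<in>A. z a * ?P a / (z c - z a))"
    unfolding sum_distrib_left sum.distrib[symmetric]
  proof (rule sum.cong[OF refl])
    fix a assume "a \<in> A"
    from pf[OF this, of "z a * ?P a"]
    show "cross t y (z c) * (z a * ?P a / (y - z a)) = z a * (cross t (z a) (z c) * ?P a) / (y - z a) +
        (1 - t) * z c / (y - z c) * (z a * ?P a / (z c - z a))"
      by (simp only: mult.left_commute)
  qed
  also have "cross t y (z c) + (1 - t) * (\<dots>) = 1 + (1 - t) * (z c * (\<Prod>b\<in>A. cross t (z c) (z b)) / (y - z c)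
      + (\<Sum>a\<in>A. z a * (cross t (z a) (z c) * ?P a) / (y - z a)))"
  proof -
    have "cross t y (z c) = 1 + (1 - t) * z c / (y - z c)"
      using nz(1) by (simp add: cross_def field_simps)
    then show ?thesis
      unfolding IH(2) by (simp add: algebra_simps add_divide_distrib diff_divide_distrib)
  qed
  also have "\<dots> = 1 + (1 - t) * (\<Sum>a\<in>insert c A. z a * (\<Prod>b\<in>insert c A - {a}. cross t (z a) (z b)) / (y - z a))"
    using insert by (simp add: split cong: sum.cong)
  finally show ?case .
qed

text \<open>The partial fraction expansion at \<open>y = 0\<close>, where the product degenerates to a power of \<open>t\<close>.\<close>
lemma sum_cross_eq_qnum:
  fixes z :: "nat \<Rightarrow> complex"
  assumes "finite A" "inj_on z A" "\<And>i. i \<in> A \<Longrightarrow> z i \<noteq> 0" "t \<noteq> 1"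
  shows "(\<Sum>a\<in>A. \<Prod>b\<in>A - {a}. cross t (z a) (z b)) = qnum t (card A)"
proof -
  have "0 \<notin> z ` A" using assms by auto
  from lagrange_expansion[OF assms(1,2) this, of t]
  have "t ^ card A = 1 - (1 - t) * (\<Sum>a\<in>A. \<Prod>b\<in>A - {a}. cross t (z a) (z b))"
    using assms(3) by (simp add: cross_def sum_negf cong: prod.cong sum.cong)
  then show ?thesis
    using assms(4) by (simp add: qnum_def field_simps)
qed

lemma qfact_Suc: "qfact t (Suc n) = qnum t (Suc n) * qfact t n"
  by (simp add: qfact_def mult.commute)

lemma hl_sum_zero:
  fixes z :: "nat \<Rightarrow> complex"
  assumes "finite A" "inj_on z A" "\<And>i. i \<in> A \<Longrightarrow> z i \<noteq> 0" "t \<noteq> 1"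
  shows "hl_sum t (replicate (card A) 0) A z = qfact t (card A)"
  using assms
proof (induction "card A" arbitrary: A)
  case 0
  then show ?case by (simp add: qfact_def)
next
  case (Suc n)
  have "hl_sum t (replicate n 0) (A - {a}) z = qfact t n" if "a \<in> A" for a
  proof -
    have "card (A - {a}) = n" using Suc.hyps(2) Suc.prems(1) that by simp
    then show ?thesis
      using Suc.hyps(1)[of "A - {a}"] Suc.prems by (auto simp: inj_on_def)
  qed
  then have "hl_sum t (replicate (Suc n) 0) A z = (\<Sum>a\<in>A. \<Prod>b\<in>A - {a}. cross t (z a) (z b)) * qfact t n"
    by (simp add: sum_distrib_right)
  also have "\<dots> = qfact t (Suc n)"
    using Suc.prems Suc.hyps(2)[symmetric] by (subst sum_cross_eq_qnum) (auto simp: qfact_Suc)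
  finally show ?case using Suc.hyps(2) by simp
qed

section \<open>Isolating one variable\<close>

text \<open>The factor of the torus weight for an ordered pair of variables.\<close>
definition dens :: "complex \<Rightarrow> complex \<Rightarrow> complex \<Rightarrow> complex" where
  "dens t a b = (1 - a * inverse b) / (1 - t * a * inverse b)"

lemma torus_weight_remove:
  assumes "finite I" "a \<in> I"
  shows "torus_weight t I z =
    (\<Prod>b\<in>I - {a}. dens t (z a) (z b)) * (\<Prod>b\<in>I - {a}. dens t (z b) (z a)) * torus_weight t (I - {a}) z"
proof -
  have "(\<Prod>j\<in>I - {i}. dens t (z i) (z j)) = dens t (z i) (z a) * (\<Prod>j\<in>I - {a} - {i}. dens t (z i) (z j))"
    if "i \<in> I - {a}" for i
  proof -
    have "I - {i} - {a} = I - {a} - {i}" by auto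
    then show ?thesis using prod.remove[of "I - {i}" a] assms that by auto
  qed
  then have "(\<Prod>i\<in>I - {a}. \<Prod>j\<in>I - {i}. dens t (z i) (z j)) =
      (\<Prod>b\<in>I - {a}. dens t (z b) (z a)) * (\<Prod>i\<in>I - {a}. \<Prod>j\<in>I - {a} - {i}. dens t (z i) (z j))"
    by (simp add: prod.distrib)
  then show ?thesis
    unfolding torus_weight_def dens_def[symmetric]
    using prod.remove[OF assms, of "\<lambda>i. \<Prod>j\<in>I - {i}. dens t (z i) (z j)"] by (simp add: mult_ac)
qed

lemma dens_cross:
  assumes "a \<noteq> b" "a \<noteq> 0" "b \<noteq> 0" "a \<noteq> t * b"
  shows "dens t b a * cross t a b = 1"
  using assms by (simp add: dens_def cross_def divide_simps)

text \<open>If \<open>a\<close> is the first variable of a summand, its poles on the diagonals within the same block are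
  cancelled by the weight. What remains, a product of \<^const>\<open>dens\<close> with \<open>z a\<close> in the numerator, is a
  power series in \<open>z a\<close> with constant term 1.\<close>
lemma torus_weight_cross:
  assumes "finite I" "a \<in> I" "\<And>b. b \<in> I - {a} \<Longrightarrow> z a \<noteq> z b \<and> z a \<noteq> t * z b" "\<And>b. b \<in> I \<Longrightarrow> z b \<noteq> 0"
  shows "torus_weight t I z * (\<Prod>b\<in>I - {a}. cross t (z a) (z b)) =
    (\<Prod>b\<in>I - {a}. dens t (z a) (z b)) * torus_weight t (I - {a}) z"
proof -
  have "(\<Prod>b\<in>I - {a}. dens t (z b) (z a)) * (\<Prod>b\<in>I - {a}. cross t (z a) (z b)) = 1"
    unfolding prod.distrib[symmetric] using assms by (intro prod.neutral ballI dens_cross) auto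
  moreover have "p * q * w * c = p * w" if "q * c = 1" for p q w c :: complex
    using that by algebra
  ultimately show ?thesis
    unfolding torus_weight_remove[OF assms(1,2)] by blast
qed

text \<open>For a variable \<open>u\<close> outside \<open>A\<close>, multiplying the symmetrized sum by \<open>dens t u (z b)\<close> for all \<open>b\<close> in \<open>A\<close>
  removes the poles in \<open>u\<close>: every \<open>b\<close> before \<open>u\<close> contributes 1, and every \<open>b\<close> after \<open>u\<close> contributes
  \<open>(t - u / b) / (1 - t u / b)\<close>. If no exponent is below
  \<open>-k\<close>, the result times \<open>u\<close> to the power \<open>k\<close> is holomorphic in the closed disc whose radius is the
  smallest of the absolute values of the \<open>z b\<close>. This function is its manifestly holomorphic form, again
  organized by the first variable.\<close>
fun hl_res :: "complex \<Rightarrow> int \<Rightarrow> int list \<Rightarrow> nat set \<Rightarrow> (nat \<Rightarrow> complex) \<Rightarrow> complex \<Rightarrow> complex" where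
  "hl_res t k [] A z u = 0"
| "hl_res t k (l # ls) A z u =
     u ^ nat (k + l) * (\<Prod>b\<in>A. (t - u * inverse (z b)) / (1 - t * u * inverse (z b))) * hl_sum t ls A z +
     (\<Sum>a\<in>A. z a powi l * (\<Prod>b\<in>A - {a}. cross t (z a) (z b)) * hl_res t k ls (A - {a}) z u)"

lemma hl_res_eq:
  assumes "finite A" "c \<notin> A" "length ls = Suc (card A)" "inj_on z (insert c A)"
    "\<And>i. i \<in> insert c A \<Longrightarrow> z i \<noteq> 0" "\<And>b. b \<in> A \<Longrightarrow> z b \<noteq> t * z c" "\<forall>l\<in>set ls. 0 \<le> k + l"
  shows "z c powi k * (\<Prod>b\<in>A. dens t (z c) (z b)) * hl_sum t ls (insert c A) z = hl_res t k ls A z (z c)"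
  using assms
proof (induction ls arbitrary: A)
  case (Cons l ls)
  let ?u = "z c"
  note prems = Cons.prems
  have dist: "z a \<noteq> ?u" "?u \<noteq> z a" if "a \<in> A" for a
    using prems that by (auto simp: inj_on_def)
  have first: "dens t ?u (z b) * cross t ?u (z b) = (t - ?u * inverse (z b)) / (1 - t * ?u * inverse (z b))"
    if "b \<in> A" for b
    using dist[OF that] prems(5)[of b] prems(6)[of b] that
    by (simp add: dens_def cross_def divide_simps) (simp add: algebra_simps)
  have other: "dens t ?u (z a) * cross t (z a) ?u = 1" if "a \<in> A" for a
    using dist[OF that] prems(5,6) that by (intro dens_cross) auto
  have IH: "?u powi k * (\<Prod>b\<in>A - {a}. dens t ?u (z b)) * hl_sum t ls (insert c (A - {a})) z
      = hl_res t k ls (A - {a}) z ?u" if "a \<in> A" for a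
    using prems that card_Suc_Diff1[OF prems(1) that] by (intro Cons.IH) (auto simp: inj_on_def)
  have "?u powi k * (\<Prod>b\<in>A. dens t ?u (z b)) * hl_sum t (l # ls) (insert c A) z =
     ?u powi k * (\<Prod>b\<in>A. dens t ?u (z b)) * (?u powi l * (\<Prod>b\<in>A. cross t ?u (z b)) * hl_sum t ls A z) +
     (\<Sum>a\<in>A. ?u powi k * (\<Prod>b\<in>A. dens t ?u (z b)) *
        (z a powi l * (\<Prod>b\<in>insert c A - {a}. cross t (z a) (z b)) * hl_sum t ls (insert c A - {a}) z))"
    using prems(1,2) by (simp add: distrib_left sum_distrib_left)
  also have "?u powi k * (\<Prod>b\<in>A. dens t ?u (z b)) * (?u powi l * (\<Prod>b\<in>A. cross t ?u (z b)) * hl_sum t ls A z)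
     = ?u ^ nat (k + l) * (\<Prod>b\<in>A. (t - ?u * inverse (z b)) / (1 - t * ?u * inverse (z b))) * hl_sum t ls A z"
  proof -
    have "?u powi k * ?u powi l = ?u ^ nat (k + l)"
      using prems(5)[of c] prems(7) power_int_add[of ?u k l] by (simp add: power_int_def)
    moreover have "(\<Prod>b\<in>A. dens t ?u (z b)) * (\<Prod>b\<in>A. cross t ?u (z b)) =
        (\<Prod>b\<in>A. (t - ?u * inverse (z b)) / (1 - t * ?u * inverse (z b)))"
      unfolding prod.distrib[symmetric] by (intro prod.cong refl first)
    moreover have "p * d * (q * c * h) = r * e * h" if "p * q = r" "d * c = e" for p q r d c e h :: complex
      unfolding that[symmetric] by (simp add: mult_ac)
    ultimately show ?thesis by blast
  qed
  also have "(\<Sum>a\<in>A. ?u powi k * (\<Prod>b\<in>A. dens t ?u (z b)) *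
        (z a powi l * (\<Prod>b\<in>insert c A - {a}. cross t (z a) (z b)) * hl_sum t ls (insert c A - {a}) z)) =
     (\<Sum>a\<in>A. z a powi l * (\<Prod>b\<in>A - {a}. cross t (z a) (z b)) * hl_res t k ls (A - {a}) z ?u)"
  proof (rule sum.cong[OF refl])
    fix a assume a: "a \<in> A"
    have set: "insert c A - {a} = insert c (A - {a})" using a prems(2) by auto
    have 1: "(\<Prod>b\<in>insert c A - {a}. cross t (z a) (z b)) = cross t (z a) ?u * (\<Prod>b\<in>A - {a}. cross t (z a) (z b))"
      using prems(1,2) by (simp add: set)
    have 2: "(\<Prod>b\<in>A. dens t ?u (z b)) = dens t ?u (z a) * (\<Prod>b\<in>A - {a}. dens t ?u (z b))"
      using prems(1) a by (rule prod.remove)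
    have "k * (d * e) * (l * (c * f) * h) = l * f * (k * e * h)" if "d * c = 1" for k d e l c f h :: complex
      using that by algebra
    from this[OF other[OF a]]
    show "?u powi k * (\<Prod>b\<in>A. dens t ?u (z b)) *
        (z a powi l * (\<Prod>b\<in>insert c A - {a}. cross t (z a) (z b)) * hl_sum t ls (insert c A - {a}) z) =
      z a powi l * (\<Prod>b\<in>A - {a}. cross t (z a) (z b)) * hl_res t k ls (A - {a}) z ?u"
      unfolding IH[OF a, symmetric] 1 2 unfolding set .
  qed
  finally show ?case by simp
qed simp

lemma qnum_Suc: "t \<noteq> 1 \<Longrightarrow> qnum t (Suc n) = t ^ n + qnum t n"
  by (simp add: qnum_def field_simps)

lemma sorted_wrt_ge_last:
  "sorted_wrt (\<ge>) xs \<Longrightarrow> x \<in> set xs \<Longrightarrow> last xs \<le> (x :: int)"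
  by (induction xs) (auto dest: last_in_set)

lemma count_list_replicate: "count_list (replicate n x) x = n"
  by (induction n) simp_all

lemma Cons_butlast_replicate: "0 < n \<Longrightarrow> x # butlast (replicate n x) = replicate n x"
  by (induction n) auto

text \<open>At \<open>u = 0\<close> only those positions of \<open>u\<close> survive whose exponent equals \<open>-k\<close>. These are the last
  ones, and the position followed by \<open>j\<close> other variables contributes \<open>t ^ j\<close>; the geometric sum is a
  \<open>t\<close>-number, and in each case the remaining exponents are those of \<open>butlast ls\<close>.\<close>
lemma hl_res_0:
  assumes "finite A" "length ls = Suc (card A)" "sorted_wrt (\<ge>) ls" "0 \<le> k + last ls" "t \<noteq> 1"
  shows "hl_res t k ls A z 0 =
    (if k + last ls = 0 then qnum t (count_list ls (last ls)) * hl_sum t (butlast ls) A z else 0)"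
  using assms
proof (induction ls arbitrary: A)
  case (Cons l ls)
  show ?case
  proof (cases "ls = []")
    case True
    then show ?thesis using Cons.prems by (auto simp: qnum_def)
  next
    case False
    then have len: "length ls > 0" and last: "last (l # ls) = last ls"
      by simp_all
    have card: "card A = length ls"
      using Cons.prems(2) by simp
    then have "card A > 0" using len by metis
    have le: "last ls \<le> l" using Cons.prems False by auto
    have IH: "hl_res t k ls (A - {a}) z 0 = (if k + last ls = 0
        then qnum t (count_list ls (last ls)) * hl_sum t (butlast ls) (A - {a}) z else 0)" if "a \<in> A" for a
      using Cons.prems card_Suc_Diff1[OF Cons.prems(1) that] card \<open>card A > 0\<close> that last by (intro Cons.IH) auto
    have rest: "(\<Sum>a\<in>A. z a powi l * (\<Prod>b\<in>A - {a}. cross t (z a) (z b)) * hl_res t k ls (A - {a}) z 0) =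
      (if k + last ls = 0 then qnum t (count_list ls (last ls)) * hl_sum t (l # butlast ls) A z else 0)"
      by (simp add: IH sum_distrib_left mult_ac cong: sum.cong)
    show ?thesis
    proof (cases "k + l = 0")
      case True
      \<comment> \<open>All exponents equal \<open>-k\<close>, so deleting this one or the last one leaves the same list. The variable
        \<open>u\<close> in this position is followed by all the others and contributes \<open>t ^ card A\<close>; the later positions
        are covered by the induction hypothesis.\<close>
      then have "last ls = l" using le Cons.prems last by simp
      then have all: "x = l" if "x \<in> set ls" for x
      proof -
        have "last ls \<le> x"
          using that Cons.prems(3) by (intro sorted_wrt_ge_last) auto
        moreover have "x \<le> l" using that Cons.prems(3) by simp
        ultimately show ?thesis using \<open>last ls = l\<close> by simp
      qed
      then have rep: "replicate (length ls) l = ls" by (intro replicate_length_same) auto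
      then have "count_list ls l = length ls" "l # butlast ls = ls"
        using count_list_replicate[of "length ls" l] Cons_butlast_replicate[OF len, of l]
        unfolding rep by simp_all
      moreover have "last (l # ls) = l" "k + last ls = 0" "count_list (l # ls) l = Suc (count_list ls l)"
        "butlast (l # ls) = l # butlast ls"
        using True last \<open>last ls = l\<close> False by simp_all
      moreover have "hl_res t k (l # ls) A z 0 = t ^ card A * hl_sum t ls A z +
          (\<Sum>a\<in>A. z a powi l * (\<Prod>b\<in>A - {a}. cross t (z a) (z b)) * hl_res t k ls (A - {a}) z 0)"
        using True by simp
      ultimately show ?thesis
        unfolding rest using True Cons.prems(5) \<open>last ls = l\<close>
        by (simp only: if_True card qnum_Suc[OF Cons.prems(5)] distrib_right)
    next
      case neq: False
      then have pos: "k + l > 0" using le Cons.prems(4) last by simp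
      then have "hl_res t k (l # ls) A z 0 =
          (\<Sum>a\<in>A. z a powi l * (\<Prod>b\<in>A - {a}. cross t (z a) (z b)) * hl_res t k ls (A - {a}) z 0)"
        by simp
      moreover have "count_list (l # ls) (last ls) = count_list ls (last ls)" if "k + last ls = 0"
        using that neq by auto
      moreover have "butlast (l # ls) = l # butlast ls" using False by simp
      ultimately show ?thesis unfolding last rest by simp
    qed
  qed
qed simp

section \<open>Integration over the torus\<close>

lemma circle_param_measurable [measurable]: "(\<lambda>\<theta>::real. cis (2 * pi * \<theta>)) \<in> borel_measurable borel"
  by (intro borel_measurable_continuous_onI continuous_intros)

lemma prob_space_circle: "prob_space circle_measure"
  unfolding circle_measure_def
  by (intro prob_space.prob_space_distr prob_space_uniform_measure) auto

lemma sets_circle [simp, measurable_cong]: "sets circle_measure = sets borel"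
  by (simp add: circle_measure_def)

lemma space_circle [simp]: "space circle_measure = UNIV"
  by (simp add: circle_measure_def)

interpretation circle: prob_space circle_measure by (rule prob_space_circle)

interpretation torus: product_sigma_finite "\<lambda>_::nat. circle_measure"
  by (intro product_sigma_finite.intro circle.sigma_finite_measure_axioms)

abbreviation torus :: "nat set \<Rightarrow> (nat \<Rightarrow> complex) measure" where
  "torus I \<equiv> PiM I (\<lambda>_. circle_measure)"

lemma prob_space_torus: "prob_space (torus I)"
  by (intro prob_space_PiM prob_space_circle)

lemma AE_circle_norm: "AE u in circle_measure. norm u = 1"
  unfolding circle_measure_def by (subst AE_distr_iff) auto

lemma AE_circle_neq: "AE u in circle_measure. u \<noteq> c"
proof -
  have "countable {\<theta>. cis (2 * pi * \<theta>) = c}"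
  proof (cases "\<exists>\<theta>0. cis (2 * pi * \<theta>0) = c")
    case True
    then obtain \<theta>0 where "cis (2 * pi * \<theta>0) = c" by blast
    then have "{\<theta>. cis (2 * pi * \<theta>) = c} \<subseteq> range (\<lambda>n::int. \<theta>0 + n)"
    proof safe
      fix \<theta> assume "cis (2 * pi * \<theta>) = cis (2 * pi * \<theta>0)"
      then obtain n :: int where "2 * pi * \<theta> = 2 * pi * \<theta>0 + 2 * pi * n"
      proof -
        from \<open>cis (2 * pi * \<theta>) = cis (2 * pi * \<theta>0)\<close>
        obtain n :: int where "\<i> * of_real (2 * pi * \<theta>) = \<i> * of_real (2 * pi * \<theta>0) + of_int (2 * n) * pi * \<i>"
          unfolding cis_conv_exp exp_eq by auto
        then have "\<i> * of_real (2 * pi * \<theta>) = \<i> * of_real (2 * pi * \<theta>0 + 2 * pi * n)"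
          by (simp add: algebra_simps)
        then have "2 * pi * \<theta> = 2 * pi * \<theta>0 + 2 * pi * n"
          by (simp only: mult_cancel_left of_real_eq_iff) simp
        then show ?thesis by (rule that)
      qed
      then have "2 * pi * \<theta> = 2 * pi * (\<theta>0 + n)" by (simp add: distrib_left)
      then have "\<theta> = \<theta>0 + n" by simp
      then show "\<theta> \<in> range (\<lambda>n::int. \<theta>0 + n)" by simp
    qed
    then show ?thesis by (rule countable_subset) simp
  qed auto
  then have "AE \<theta> in lborel. \<theta> \<notin> {\<theta>. cis (2 * pi * \<theta>) = c}"
    by (intro AE_not_in countable_imp_null_set_lborel)
  then have "AE \<theta> in uniform_measure lborel {0..1}. cis (2 * pi * \<theta>) \<noteq> c"
    by (intro AE_uniform_measureI) auto
  then show ?thesis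
    unfolding circle_measure_def by (subst AE_distr_iff) auto
qed

text \<open>Cauchy's integral formula for the uniform measure on the circle. The factor \<open>u\<close> in the numerator
  turns that measure into the differential \<open>du / (2 \<pi> \<i>)\<close>.\<close>
lemma circle_cauchy:
  assumes holo: "h holomorphic_on cball 0 1" and [measurable]: "h \<in> borel_measurable borel"
    and a: "norm a < 1"
  shows "integrable circle_measure (\<lambda>u. h u * (u / (u - a)))" (is ?int)
    and "(LINT u|circle_measure. h u * (u / (u - a))) = h a" (is ?eq)
proof -
  define e where "e \<theta> = cis (2 * pi * \<theta>)" for \<theta> :: real
  define G where "G \<theta> = h (e \<theta>) * (e \<theta> / (e \<theta> - a))" for \<theta>
  have [measurable]: "e \<in> borel_measurable borel"
    unfolding e_def by measurable
  have ne: "e \<theta> - a \<noteq> 0" for \<theta>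
    using a by (auto simp: e_def)
  have "((\<lambda>u. h u / (u - a)) has_contour_integral (2 * of_real pi * \<i> * h a)) (circlepath 0 1)"
    using holo a by (intro Cauchy_integral_circlepath holomorphic_on_imp_continuous_on)
      (auto intro: holomorphic_on_subset)
  then have "((\<lambda>\<theta>. h (circlepath 0 1 \<theta>) / (circlepath 0 1 \<theta> - a) *
      vector_derivative (circlepath 0 1) (at \<theta> within {0..1})) has_integral (2 * of_real pi * \<i> * h a)) {0..1}"
    by (simp add: has_contour_integral_def)
  then have "((\<lambda>\<theta>. 2 * of_real pi * \<i> * G \<theta>) has_integral (2 * of_real pi * \<i> * h a)) {0..1}"
  proof (rule has_integral_eq[rotated])
    fix \<theta> :: real assume "\<theta> \<in> {0..1}"
    then have "vector_derivative (circlepath 0 1) (at \<theta> within {0..1}) = 2 * of_real pi * \<i> * e \<theta>"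
      using vector_derivative_circlepath01[of \<theta> 0 1] by (simp add: e_def cis_conv_exp mult_ac)
    moreover have "circlepath 0 1 \<theta> = e \<theta>"
      by (simp add: e_def cis_conv_exp circlepath mult_ac)
    ultimately show "h (circlepath 0 1 \<theta>) / (circlepath 0 1 \<theta> - a) *
        vector_derivative (circlepath 0 1) (at \<theta> within {0..1}) = 2 * of_real pi * \<i> * G \<theta>"
      by (simp add: G_def)
  qed
  from has_integral_mult_right[OF this, of "1 / (2 * of_real pi * \<i>)"]
  have hk: "(G has_integral h a) {0..1}" by simp
  have "continuous_on {0..1} G"
    unfolding G_def
  proof (intro continuous_on_mult continuous_on_divide continuous_on_diff continuous_on_const ne ballI)
    show "continuous_on {0..1} e" unfolding e_def by (intro continuous_intros)
    then show "continuous_on {0..1} e" .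
    show "continuous_on {0..1} (\<lambda>\<theta>. h (e \<theta>))"
      using holomorphic_on_imp_continuous_on[OF holo] unfolding e_def
      by (rule continuous_on_compose2) (auto intro!: continuous_intros)
  qed
  then have int: "set_integrable lborel {0..1} G" by (rule borel_integrable_atLeastAtMost')
  then have L: "(LINT \<theta>:{0..1}|lborel. G \<theta>) = h a"
    using hk by (simp add: set_borel_integral_eq_integral integral_unique)
  have unif: "uniform_measure lborel {0..1::real} = density lborel (\<lambda>x. ennreal (indicator {0..1} x))"
    by (simp add: uniform_measure_def ennreal_indicator divide_ennreal_def)
  have [measurable]: "G \<in> borel_measurable borel" unfolding G_def by measurable
  have "integrable (uniform_measure lborel {0..1}) G"
    using int unfolding unif set_integrable_def by (subst integrable_density) auto
  then show ?int
    unfolding circle_measure_def by (subst integrable_distr_eq) (auto simp: G_def[abs_def] e_def)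
  have "(LINT u|circle_measure. h u * (u / (u - a))) = (LINT \<theta>|uniform_measure lborel {0..1}. G \<theta>)"
    unfolding circle_measure_def G_def e_def by (rule integral_distr) measurable
  also have "\<dots> = (LINT \<theta>:{0..1}|lborel. G \<theta>)"
    unfolding unif set_lebesgue_integral_def by (rule integral_density) auto
  finally show ?eq using L by simp
qed

lemma circle_mean_value:
  assumes holo: "h holomorphic_on cball 0 1" and meas: "h \<in> borel_measurable borel"
  shows "integrable circle_measure h" "(LINT u|circle_measure. h u) = h 0"
proof -
  have ae: "AE u in circle_measure. h u * (u / (u - 0)) = h u"
    using AE_circle_neq[of 0] by eventually_elim simp
  have "(\<lambda>u. h u * (u / (u - 0))) \<in> borel_measurable circle_measure"
    "h \<in> borel_measurable circle_measure"
    using meas by measurable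
  note eqs = integrable_cong_AE[OF this ae] integral_cong_AE[OF this ae]
  show "integrable circle_measure h" "(LINT u|circle_measure. h u) = h 0"
    using eqs circle_cauchy[OF assms, of 0] by simp_all
qed
lemma AE_torus_norm: "finite I \<Longrightarrow> AE z in torus I. \<forall>i\<in>I. norm (z i) = 1"
  by (intro AE_finite_allI AE_PiM_component prob_space_circle AE_circle_norm)

text \<open>Given all the other coordinates, the coordinate \<open>i\<close> avoids the single value \<open>z j\<close> almost surely.\<close>
lemma AE_torus_neq:
  assumes "finite I" "i \<in> I" "j \<in> I" "i \<noteq> j"
  shows "AE z in torus I. z i \<noteq> z j"
proof -
  define I' where "I' = I - {i}"
  have I: "I = insert i I'" "finite I'" "i \<notin> I'" "j \<in> I'" using assms by (auto simp: I'_def)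
  let ?S = "{z \<in> space (torus I). z i = z j}"
  have [measurable]: "?S \<in> sets (torus I)" using assms by measurable
  have "emeasure (torus I) ?S = (\<integral>\<^sup>+ z. indicator ?S z \<partial>torus I)" by simp
  also have "\<dots> = (\<integral>\<^sup>+ x. \<integral>\<^sup>+ u. indicator ?S (x(i := u)) \<partial>circle_measure \<partial>torus I')"
    unfolding I(1) by (rule torus.product_nn_integral_insert) (use I in \<open>auto simp: I(1)[symmetric]\<close>)
  also have "\<dots> = (\<integral>\<^sup>+ x. 0 \<partial>torus I')"
  proof (rule nn_integral_cong)
    fix x :: "nat \<Rightarrow> complex"
    have "(\<integral>\<^sup>+ u. indicator ?S (x(i := u)) \<partial>circle_measure) = (\<integral>\<^sup>+ u. 0 \<partial>circle_measure)"
      using AE_circle_neq[of "x j"] assms(4) by (intro nn_integral_cong_AE) (auto elim!: eventually_mono)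
    then show "(\<integral>\<^sup>+ u. indicator ?S (x(i := u)) \<partial>circle_measure) = 0" by simp
  qed
  finally show ?thesis by (intro AE_I[of _ _ ?S]) auto
qed

lemma AE_torus_inj:
  assumes "finite I" shows "AE z in torus I. inj_on z I"
proof -
  have "AE z in torus I. \<forall>i\<in>I. \<forall>j\<in>I. i \<noteq> j \<longrightarrow> z i \<noteq> z j"
    using assms AE_torus_neq by (intro AE_finite_allI) auto
  then show ?thesis by (rule eventually_mono) (auto simp: inj_on_def)
qed

lemma AE_torus:
  assumes "finite I" "\<And>z. inj_on z I \<Longrightarrow> (\<And>i. i \<in> I \<Longrightarrow> norm (z i) = 1) \<Longrightarrow> P z"
  shows "AE z in torus I. P z"
  using AE_torus_inj[OF assms(1)] AE_torus_norm[OF assms(1)] by eventually_elim (use assms(2) in auto)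

text \<open>A condition that is closed under products, unlike integrability, and implies integrability over the torus.\<close>
definition tame :: "nat set \<Rightarrow> ((nat \<Rightarrow> complex) \<Rightarrow> complex) \<Rightarrow> bool" where
  "tame I f \<longleftrightarrow> f \<in> borel_measurable (torus I) \<and> (\<exists>C. AE z in torus I. norm (f z) \<le> C)"

lemma tame_integrable: "tame I f \<Longrightarrow> integrable (torus I) f"
  unfolding tame_def
  using finite_measure.integrable_const_bound[OF prob_space.finite_measure[OF prob_space_torus]] by blast

lemma tame_mult: "tame I f \<Longrightarrow> tame I g \<Longrightarrow> tame I (\<lambda>z. f z * g z)"
  unfolding tame_def
proof (intro conjI; elim conjE exE)
  fix C D assume "AE z in torus I. norm (f z) \<le> C" "AE z in torus I. norm (g z) \<le> D"
  then have "AE z in torus I. norm (f z * g z) \<le> C * D"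
    by eventually_elim (auto simp: norm_mult intro!: mult_mono intro: order_trans[OF norm_ge_zero])
  then show "\<exists>C. AE z in torus I. norm (f z * g z) \<le> C" by blast
qed (rule borel_measurable_times)

lemma tame_cong:
  assumes "tame I f" "finite I" "g \<in> borel_measurable (torus I)"
    "\<And>z. inj_on z I \<Longrightarrow> (\<And>i. i \<in> I \<Longrightarrow> norm (z i) = 1) \<Longrightarrow> f z = g z"
  shows "tame I g" "integral\<^sup>L (torus I) f = integral\<^sup>L (torus I) g"
proof -
  have eq: "AE z in torus I. f z = g z" using assms(2,4) by (rule AE_torus)
  obtain C where "AE z in torus I. norm (f z) \<le> C" using assms(1) by (auto simp: tame_def)
  with eq have "AE z in torus I. norm (g z) \<le> C" by eventually_elim auto
  with assms(3) show "tame I g" by (auto simp: tame_def)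
  show "integral\<^sup>L (torus I) f = integral\<^sup>L (torus I) g"
    using assms(1,3) eq by (intro integral_cong_AE) (auto simp: tame_def)
qed

lemma tame_boundI:
  assumes "finite I" "f \<in> borel_measurable (torus I)"
    "\<And>z. inj_on z I \<Longrightarrow> (\<And>i. i \<in> I \<Longrightarrow> norm (z i) = 1) \<Longrightarrow> norm (f z) \<le> C"
  shows "tame I f"
  using assms AE_torus[OF assms(1), of "\<lambda>z. norm (f z) \<le> C"] by (auto simp: tame_def)

text \<open>The form of Fubini's theorem in which a variable is integrated out. The inner integral need only be
  known where the other variables lie on the circle and are pairwise distinct.\<close>
lemma torus_integral_insert:
  assumes f: "tame I f" and I: "finite I" "i \<in> I" and [measurable]: "g \<in> borel_measurable (torus (I - {i}))"
    and g: "\<And>z. (\<And>j. j \<in> I - {i} \<Longrightarrow> norm (z j) = 1) \<Longrightarrow> inj_on z (I - {i}) \<Longrightarrow>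
        (LINT u|circle_measure. f (z(i := u))) = g z"
  shows "integral\<^sup>L (torus I) f = integral\<^sup>L (torus (I - {i})) g"
proof -
  have ins: "insert i (I - {i}) = I" using I by auto
  have "integral\<^sup>L (torus (insert i (I - {i}))) f =
      (LINT z|torus (I - {i}). LINT u|circle_measure. f (z(i := u)))"
    using I tame_integrable[OF f] by (intro torus.product_integral_insert) (simp_all only: ins, simp_all)
  also have "\<dots> = integral\<^sup>L (torus (I - {i})) g"
  proof (rule integral_cong_AE)
    have [measurable]: "f \<in> borel_measurable (torus (insert i (I - {i})))"
      using f unfolding ins tame_def by simp
    have "(\<lambda>(z, u). f (z(i := u))) \<in> borel_measurable (torus (I - {i}) \<Otimes>\<^sub>M circle_measure)"
      using measurable_compose[OF measurable_add_dim \<open>f \<in> borel_measurable (torus (insert i (I - {i})))\<close>]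
      by (simp add: case_prod_unfold)
    then show "(\<lambda>z. LINT u|circle_measure. f (z(i := u))) \<in> borel_measurable (torus (I - {i}))"
      by (rule circle.borel_measurable_lebesgue_integral)
    show "AE z in torus (I - {i}). (LINT u|circle_measure. f (z(i := u))) = g z"
      using I g by (intro AE_torus) auto
  qed measurable
  finally show ?thesis unfolding ins .
qed

lemma component_measurable: "i \<in> I \<Longrightarrow> (\<lambda>z. z i) \<in> borel_measurable (torus I)"
  by measurable

lemma borel_measurable_powi:
  fixes f :: "'a \<Rightarrow> complex"
  assumes [measurable]: "f \<in> borel_measurable M"
  shows "(\<lambda>x. f x powi k) \<in> borel_measurable M"
  unfolding power_int_def by (cases "k \<ge> 0") simp_all

lemma torus_weight_measurable:
  assumes "J \<subseteq> I" shows "torus_weight t J \<in> borel_measurable (torus I)"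
proof -
  have [measurable]: "(\<lambda>z. z i) \<in> borel_measurable (torus I)" if "i \<in> J" for i
    using assms that by (intro component_measurable) auto
  have "(\<lambda>z. (1 - z i * inverse (z j)) / (1 - t * z i * inverse (z j))) \<in> borel_measurable (torus I)"
    if "i \<in> J" "j \<in> J - {i}" for i j
    using that by (intro borel_measurable_divide borel_measurable_diff borel_measurable_times borel_measurable_inverse) auto
  then show ?thesis
    unfolding torus_weight_def by (intro borel_measurable_prod) auto
qed

lemma norm_dens_le:
  assumes "norm t < 1" "norm a \<le> 1" "norm b = 1"
  shows "norm (dens t a b) \<le> 2 / (1 - norm t)"
proof -
  have "norm (1 - a * inverse b) \<le> 2"
    using norm_triangle_ineq4[of 1 "a * inverse b"] assms by (simp add: norm_mult norm_inverse)
  moreover have "norm (t * a * inverse b) \<le> norm t"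
    using assms by (simp add: norm_mult norm_inverse mult_left_le)
  then have "1 - norm t \<le> norm (1 - t * a * inverse b)"
    using norm_triangle_ineq2[of 1 "t * a * inverse b"] by simp
  ultimately show ?thesis
    unfolding dens_def norm_divide using assms by (intro frac_le) auto
qed

lemma norm_prod_le_const:
  fixes f :: "nat \<Rightarrow> complex"
  assumes "\<And>i. i \<in> S \<Longrightarrow> norm (f i) \<le> C i"
  shows "norm (prod f S) \<le> prod C S"
  unfolding prod_norm[symmetric] using assms by (intro prod_mono) auto

lemma tame_torus_weight:
  assumes "norm t < 1" "finite I" "J \<subseteq> I" shows "tame I (torus_weight t J)"
proof (rule tame_boundI[OF assms(2) torus_weight_measurable[OF assms(3)]])
  fix z :: "nat \<Rightarrow> complex" assume "\<And>i. i \<in> I \<Longrightarrow> norm (z i) = 1"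
  then show "norm (torus_weight t J z) \<le> (\<Prod>i\<in>J. \<Prod>j\<in>J - {i}. 2 / (1 - norm t))"
    unfolding torus_weight_def dens_def[symmetric]
    using assms by (intro norm_prod_le_const norm_dens_le) auto
qed

section \<open>The symmetrized sum is a Laurent polynomial\<close>

text \<open>Polynomial functions in the variables \<open>z i\<close>. The closure conditions suffice for divisibility by
  \<open>z i - z j\<close>, for continuity and for boundedness, which is all that is needed of polynomials in several variables.\<close>
inductive poly_fun :: "((nat \<Rightarrow> complex) \<Rightarrow> complex) \<Rightarrow> bool" where
  poly_fun_const: "poly_fun (\<lambda>z. c)"
| poly_fun_var: "poly_fun (\<lambda>z. z i)"
| poly_fun_add: "poly_fun f \<Longrightarrow> poly_fun g \<Longrightarrow> poly_fun (\<lambda>z. f z + g z)"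
| poly_fun_mult: "poly_fun f \<Longrightarrow> poly_fun g \<Longrightarrow> poly_fun (\<lambda>z. f z * g z)"

named_theorems poly_fun_intros
lemmas [poly_fun_intros] = poly_fun_const poly_fun_var poly_fun_add poly_fun_mult

lemma poly_fun_diff [poly_fun_intros]:
  assumes "poly_fun f" "poly_fun g" shows "poly_fun (\<lambda>z. f z - g z)"
  using poly_fun_add[OF assms(1) poly_fun_mult[OF poly_fun_const[of "-1"] assms(2)]] by simp

lemma poly_fun_power [poly_fun_intros]: "poly_fun f \<Longrightarrow> poly_fun (\<lambda>z. f z ^ n)"
  by (induction n) (auto intro: poly_fun_intros)

lemma poly_fun_sum [poly_fun_intros]:
  "(\<And>i. i \<in> S \<Longrightarrow> poly_fun (f i)) \<Longrightarrow> poly_fun (\<lambda>z. \<Sum>i\<in>S. f i z)"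
  by (induction S rule: infinite_finite_induct) (auto intro: poly_fun_intros)

lemma poly_fun_prod [poly_fun_intros]:
  "(\<And>i. i \<in> S \<Longrightarrow> poly_fun (f i)) \<Longrightarrow> poly_fun (\<lambda>z. \<Prod>i\<in>S. f i z)"
  by (induction S rule: infinite_finite_induct) (auto intro: poly_fun_intros)

lemma poly_fun_reindex: "poly_fun f \<Longrightarrow> poly_fun (\<lambda>z. f (\<lambda>i. z (p i)))"
  by (induction rule: poly_fun.induct) (auto intro: poly_fun_intros)

lemma poly_fun_identify:
  assumes "poly_fun f" shows "poly_fun (\<lambda>z. f (z(i := z j)))"
proof -
  have "z(i := z j) = (\<lambda>k. z (if k = i then j else k))" for z :: "nat \<Rightarrow> complex" by auto
  then show ?thesis using poly_fun_reindex[OF assms, of "\<lambda>k. if k = i then j else k"] by simp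
qed

lemma poly_fun_bounded:
  "poly_fun f \<Longrightarrow> \<exists>C. \<forall>z. (\<forall>i. norm (z i) \<le> 1) \<longrightarrow> norm (f z) \<le> C"
proof (induction rule: poly_fun.induct)
  case (poly_fun_add f g)
  then obtain C D where C: "\<And>z. \<forall>i. norm (z i) \<le> 1 \<Longrightarrow> norm (f z) \<le> C"
    "\<And>z. \<forall>i. norm (z i) \<le> 1 \<Longrightarrow> norm (g z) \<le> D" by blast
  then have "norm (f z + g z) \<le> C + D" if "\<forall>i. norm (z i) \<le> 1" for z
    using that by (meson norm_triangle_le add_mono)
  then show ?case by blast
next
  case (poly_fun_mult f g)
  then obtain C D where C: "\<And>z. \<forall>i. norm (z i) \<le> 1 \<Longrightarrow> norm (f z) \<le> C"
    "\<And>z. \<forall>i. norm (z i) \<le> 1 \<Longrightarrow> norm (g z) \<le> D" by blast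
  then have "norm (f z * g z) \<le> C * D" if "\<forall>i. norm (z i) \<le> 1" for z
    unfolding norm_mult using that by (intro mult_mono) (auto intro: order_trans[OF norm_ge_zero])
  then show ?case by blast
qed auto

lemma poly_fun_continuous: "poly_fun f \<Longrightarrow> continuous_on UNIV (\<lambda>c. f (z(i := c)))"
proof (induction rule: poly_fun.induct)
  case (poly_fun_var k)
  then show ?case by (cases "k = i") auto
qed (auto intro: continuous_intros)

text \<open>The points with distinct nonzero coordinates are dense; one coordinate is moved at a time.\<close>
lemma poly_fun_eq_0:
  assumes "poly_fun p" "finite A" "\<And>z. inj_on z A \<Longrightarrow> (\<And>i. i \<in> A \<Longrightarrow> z i \<noteq> 0) \<Longrightarrow> p z = 0"
  shows "p z = 0"
  using assms(2,3)
proof (induction A arbitrary: z rule: finite_induct)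
  case (insert a A)
  show ?case
  proof (rule insert.IH)
    fix z :: "nat \<Rightarrow> complex" assume z: "inj_on z A" "\<And>i. i \<in> A \<Longrightarrow> z i \<noteq> 0"
    let ?Z = "{c. p (z(a := c)) = 0}"
    have "p (z(a := c)) = 0" if "c \<notin> insert 0 (z ` A)" for c
    proof (rule insert.prems)
      show "inj_on (z(a := c)) (insert a A)"
        using z that insert.hyps by (auto simp: inj_on_def)
      show "(z(a := c)) i \<noteq> 0" if "i \<in> insert a A" for i
        using z that \<open>c \<notin> insert 0 (z ` A)\<close> by auto
    qed
    then have "- insert 0 (z ` A) \<subseteq> ?Z" by auto
    moreover have "closed ?Z"
      using poly_fun_continuous[OF assms(1)] by (intro closed_Collect_eq) auto
    ultimately have "closure (- insert 0 (z ` A)) \<subseteq> ?Z" by (rule closure_minimal)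
    moreover have "interior (insert 0 (z ` A)) = {}"
      using insert.hyps by (intro empty_interior_finite) auto
    ultimately have "UNIV \<subseteq> ?Z" by (simp add: closure_complement)
    then have "z a \<in> ?Z" by blast
    then show "p z = 0" by simp
  qed
qed auto

lemma poly_fun_diff_quotient:
  "poly_fun f \<Longrightarrow> \<exists>g. poly_fun g \<and> (\<forall>z. f z - f (z(i := z j)) = (z i - z j) * g z)"
proof (induction rule: poly_fun.induct)
  case (poly_fun_const c)
  then show ?case by (intro exI[of _ "\<lambda>z. 0"]) (auto intro: poly_fun_intros)
next
  case (poly_fun_var k)
  then show ?case
    by (intro exI[of _ "\<lambda>z. if k = i then 1 else 0"]) (auto intro: poly_fun_intros)
next
  case (poly_fun_add f1 f2)
  then obtain g1 g2 where g: "poly_fun g1" "\<And>z. f1 z - f1 (z(i := z j)) = (z i - z j) * g1 z"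
    "poly_fun g2" "\<And>z. f2 z - f2 (z(i := z j)) = (z i - z j) * g2 z" by blast
  have "a + b - (a' + b') = d * (g + h)" if "a - a' = d * g" "b - b' = d * h" for a b a' b' d g h :: complex
    using that by algebra
  with g show ?case
    by (intro exI[of _ "\<lambda>z. g1 z + g2 z"]) (blast intro: poly_fun_intros)
next
  case (poly_fun_mult f1 f2)
  then obtain g1 g2 where g: "poly_fun g1" "\<And>z. f1 z - f1 (z(i := z j)) = (z i - z j) * g1 z"
    "poly_fun g2" "\<And>z. f2 z - f2 (z(i := z j)) = (z i - z j) * g2 z" by blast
  have "a * b - a' * b' = d * (a * h + g * b')" if "a - a' = d * g" "b - b' = d * h"
    for a b a' b' d g h :: complex
    using that by algebra
  then have "f1 z * f2 z - f1 (z(i := z j)) * f2 (z(i := z j)) =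
      (z i - z j) * (f1 z * g2 z + g1 z * f2 (z(i := z j)))" for z
    using g by blast
  moreover have "poly_fun (\<lambda>z. f1 z * g2 z + g1 z * f2 (z(i := z j)))"
    by (intro poly_fun_intros poly_fun_identify g poly_fun_mult.hyps)
  ultimately show ?case by blast
qed

text \<open>A polynomial function that vanishes on several diagonals is divisible by the product of the
  corresponding differences. After division by some of them, the quotient still vanishes on the next
  diagonal, because it does so at the points of that diagonal where the other differences are nonzero,
  and these points are dense in it.\<close>
lemma poly_fun_divide_differences:
  assumes "poly_fun f" "finite A" "S \<subseteq> {(i, j). i \<in> A \<and> j \<in> A \<and> i < j}"
    "\<And>i j z. (i, j) \<in> S \<Longrightarrow> z i = z j \<Longrightarrow> f z = 0"
  shows "\<exists>g. poly_fun g \<and> (\<forall>z. f z = (\<Prod>(i, j)\<in>S. z i - z j) * g z)"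
proof -
  have "finite S" using assms(2,3) by (rule_tac finite_subset[of _ "A \<times> A"]) auto
  then show ?thesis using assms(3,4)
  proof (induction S rule: finite_induct)
    case empty
    then show ?case using assms(1) by auto
  next
    case (insert s S)
    obtain k l where s: "s = (k, l)" by (cases s)
    then have kl: "k \<in> A" "l \<in> A" "k < l" "(k, l) \<notin> S" using insert by auto
    obtain g where g: "poly_fun g" "\<And>z. f z = (\<Prod>(i, j)\<in>S. z i - z j) * g z"
      using insert by blast
    have g0: "g (z(k := z l)) = 0" for z
    proof (rule poly_fun_eq_0[OF poly_fun_identify[OF g(1)] assms(2)])
      fix z :: "nat \<Rightarrow> complex" assume inj: "inj_on z A"
      let ?z = "z(k := z l)"
      have "?z i - ?z j \<noteq> 0" if "(i, j) \<in> S" for i j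
      proof -
        have "i \<in> A" "j \<in> A" "i < j" using that insert.prems(1) by auto
        then show ?thesis using that kl inj by (auto simp: inj_on_def)
      qed
      then have "(\<Prod>(i, j)\<in>S. ?z i - ?z j) \<noteq> 0"
        using insert.hyps by (auto simp: prod_zero_iff)
      moreover have "f ?z = 0" using kl by (intro insert.prems(2)[of k l]) (auto simp: s)
      ultimately show "g ?z = 0" using g(2)[of ?z] by simp
    qed
    obtain h where h: "poly_fun h" "\<And>z. g z - g (z(k := z l)) = (z k - z l) * h z"
      using poly_fun_diff_quotient[OF g(1)] by blast
    have "f z = (\<Prod>(i, j)\<in>insert s S. z i - z j) * h z" for z
      using g(2)[of z] g0[of z] h(2)[of z] insert.hyps by (simp add: s mult_ac)
    with h(1) show ?case by blast
  qed
qed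

definition vandermonde :: "nat set \<Rightarrow> (nat \<Rightarrow> complex) \<Rightarrow> complex" where
  "vandermonde A z = (\<Prod>(i, j)\<in>{(i, j). i \<in> A \<and> j \<in> A \<and> i < j}. z i - z j)"

text \<open>The factor \<open>s\<close> is a sign that counts the indices below \<open>a\<close>. Since it is the same for all \<open>z\<close>, it can
  serve as a coefficient of a polynomial function.\<close>
lemma vandermonde_remove:
  assumes "finite A" "a \<in> A"
  shows "\<exists>s. \<forall>z. vandermonde A z = s * (\<Prod>b\<in>A - {a}. z a - z b) * vandermonde (A - {a}) z"
proof (intro exI allI)
  fix z :: "nat \<Rightarrow> complex"
  let ?P = "\<lambda>A. {(i, j). i \<in> A \<and> j \<in> A \<and> i < j}"
  let ?lo = "{b\<in>A. b < a}" and ?hi = "{b\<in>A. a < b}"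
  have fin: "finite (?P (A - {a}))"
    using assms(1) by (rule_tac finite_subset[of _ "A \<times> A"]) auto
  have "?P A = ?P (A - {a}) \<union> ((\<lambda>b. (b, a)) ` ?lo \<union> Pair a ` ?hi)"
    using assms(2) by (auto simp: image_iff)
  moreover have "?P (A - {a}) \<inter> ((\<lambda>b. (b, a)) ` ?lo \<union> Pair a ` ?hi) = {}"
    "(\<lambda>b. (b, a)) ` ?lo \<inter> Pair a ` ?hi = {}" by auto
  moreover have "finite ((\<lambda>b. (b, a)) ` ?lo)" "finite (Pair a ` ?hi)"
    using assms(1) by simp_all
  ultimately have "vandermonde A z = vandermonde (A - {a}) z *
      ((\<Prod>(i, j)\<in>(\<lambda>b. (b, a)) ` ?lo. z i - z j) * (\<Prod>(i, j)\<in>Pair a ` ?hi. z i - z j))"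
    unfolding vandermonde_def using fin by (simp only: prod.union_disjoint finite_UnI)
  also have "(\<Prod>(i, j)\<in>(\<lambda>b. (b, a)) ` ?lo. z i - z j) = (\<Prod>b\<in>?lo. (-1) * (z a - z b))"
    by (subst prod.reindex) (auto simp: inj_on_def)
  also have "\<dots> = (-1) ^ card ?lo * (\<Prod>b\<in>?lo. z a - z b)"
    unfolding prod.distrib by simp
  also have "(\<Prod>(i, j)\<in>Pair a ` ?hi. z i - z j) = (\<Prod>b\<in>?hi. z a - z b)"
    by (subst prod.reindex) (auto simp: inj_on_def)
  finally have "vandermonde A z = (-1) ^ card ?lo * ((\<Prod>b\<in>?lo. z a - z b) * (\<Prod>b\<in>?hi. z a - z b)) *
      vandermonde (A - {a}) z"
    by (simp add: mult_ac)
  also have "(\<Prod>b\<in>?lo. z a - z b) * (\<Prod>b\<in>?hi. z a - z b) = (\<Prod>b\<in>A - {a}. z a - z b)"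
  proof -
    have "A - {a} = ?lo \<union> ?hi" using assms(2) by auto
    then show ?thesis using assms(1) by (simp add: prod.union_disjoint[symmetric] disjoint_iff)
  qed
  finally show "vandermonde A z = (-1) ^ card ?lo * (\<Prod>b\<in>A - {a}. z a - z b) * vandermonde (A - {a}) z" .
qed

lemma vandermonde_nonzero: "finite A \<Longrightarrow> inj_on z A \<Longrightarrow> vandermonde A z \<noteq> 0"
  unfolding vandermonde_def
  by (subst prod_zero_iff, rule finite_subset[of _ "A \<times> A"]) (auto simp: inj_on_def)

lemma poly_fun_vandermonde [poly_fun_intros]: "poly_fun (vandermonde A)"
  unfolding vandermonde_def by (auto intro!: poly_fun_intros simp: case_prod_unfold)

lemma vandermonde_swap:
  assumes "finite A" "i \<in> A" "j \<in> A" "i \<noteq> j"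
  shows "vandermonde A (z \<circ> Transposition.transpose i j) = - vandermonde A z"
proof -
  let ?B = "A - {i} - {j}"
  let ?z = "z \<circ> Transposition.transpose i j"
  obtain s where s: "\<And>z. vandermonde A z = s * (\<Prod>b\<in>A - {i}. z i - z b) * vandermonde (A - {i}) z"
    using vandermonde_remove[OF assms(1,2)] by blast
  obtain s' where s': "\<And>z. vandermonde (A - {i}) z = s' * (\<Prod>b\<in>?B. z j - z b) * vandermonde ?B z"
    using vandermonde_remove[of "A - {i}" j] assms by auto
  have all: "vandermonde A z = s * s' * (z i - z j) * ((\<Prod>b\<in>?B. z i - z b) * (\<Prod>b\<in>?B. z j - z b)) * vandermonde ?B z" for z
    unfolding s s' using assms prod.remove[of "A - {i}" j "\<lambda>b. z i - z b"] by (simp add: mult_ac)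
  have "?z i = z j" "?z j = z i" "\<And>b. b \<in> ?B \<Longrightarrow> ?z b = z b"
    by (auto simp: Transposition.transpose_def)
  moreover from this(3) have "vandermonde ?B ?z = vandermonde ?B z"
    unfolding vandermonde_def by (intro prod.cong) auto
  moreover have "(\<Prod>b\<in>?B. c - ?z b) = (\<Prod>b\<in>?B. c - z b)" for c
    using calculation(3) by (intro prod.cong) auto
  ultimately show ?thesis unfolding all[of ?z] all[of z] by (simp add: algebra_simps)
qed

lemma hl_sum_numerator:
  assumes "finite A" "\<forall>l\<in>set ls. 0 \<le> l + int K"
  shows "\<exists>q. poly_fun q \<and> (\<forall>z. inj_on z A \<longrightarrow> (\<forall>i\<in>A. z i \<noteq> 0) \<longrightarrow>
    vandermonde A z * (\<Prod>i\<in>A. z i) ^ K * hl_sum t ls A z = q z)"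
  using assms
proof (induction ls arbitrary: A)
  case Nil
  then show ?case
    by (intro exI[of _ "\<lambda>z. vandermonde A z * (\<Prod>i\<in>A. z i) ^ K"]) (auto intro!: poly_fun_intros)
next
  case (Cons l ls)
  have "\<exists>q. poly_fun q \<and> (\<forall>z. inj_on z (A - {a}) \<longrightarrow> (\<forall>i\<in>A - {a}. z i \<noteq> 0) \<longrightarrow>
    vandermonde (A - {a}) z * (\<Prod>i\<in>A - {a}. z i) ^ K * hl_sum t ls (A - {a}) z = q z)" for a
    using Cons.prems by (intro Cons.IH) auto
  then obtain q where q: "\<And>a. poly_fun (q a)" "\<And>a z. inj_on z (A - {a}) \<Longrightarrow> (\<forall>i\<in>A - {a}. z i \<noteq> 0) \<Longrightarrow>
    vandermonde (A - {a}) z * (\<Prod>i\<in>A - {a}. z i) ^ K * hl_sum t ls (A - {a}) z = q a z" by metis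
  obtain s where s: "\<And>a z. a \<in> A \<Longrightarrow> vandermonde A z = s a * (\<Prod>b\<in>A - {a}. z a - z b) * vandermonde (A - {a}) z"
    using vandermonde_remove[OF Cons.prems(1)] by metis
  define Q where "Q z = (\<Sum>a\<in>A. s a * z a ^ nat (l + int K) * (\<Prod>b\<in>A - {a}. z a - t * z b) * q a z)" for z
  have "poly_fun Q" unfolding Q_def by (intro poly_fun_intros q)
  moreover have "vandermonde A z * (\<Prod>i\<in>A. z i) ^ K * hl_sum t (l # ls) A z = Q z"
    if z: "inj_on z A" "\<forall>i\<in>A. z i \<noteq> 0" for z
    unfolding Q_def hl_sum.simps sum_distrib_left
  proof (rule sum.cong[OF refl])
    fix a assume a: "a \<in> A"
    have 1: "(\<Prod>b\<in>A - {a}. z a - z b) * (\<Prod>b\<in>A - {a}. cross t (z a) (z b)) = (\<Prod>b\<in>A - {a}. z a - t * z b)"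
      unfolding prod.distrib[symmetric] using z a by (intro prod.cong) (auto simp: cross_def inj_on_def)
    have 2: "z a ^ K * z a powi l = z a ^ nat (l + int K)"
      using z(2) a power_int_add[of "z a" l "int K"] Cons.prems(2)
      by (simp add: power_int_def mult.commute)
    have 3: "vandermonde (A - {a}) z * (\<Prod>i\<in>A - {a}. z i) ^ K * hl_sum t ls (A - {a}) z = q a z"
      using z by (intro q) (auto intro: inj_on_subset)
    have 4: "(\<Prod>i\<in>A. z i) ^ K = z a ^ K * (\<Prod>i\<in>A - {a}. z i) ^ K"
      using prod.remove[OF Cons.prems(1) a, of z] by (simp add: power_mult_distrib)
    show "vandermonde A z * (\<Prod>i\<in>A. z i) ^ K *
        (z a powi l * (\<Prod>b\<in>A - {a}. cross t (z a) (z b)) * hl_sum t ls (A - {a}) z) =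
      s a * z a ^ nat (l + int K) * (\<Prod>b\<in>A - {a}. z a - t * z b) * q a z"
      unfolding s[OF a] 4 1[symmetric] 2[symmetric] 3[symmetric] by (simp add: mult_ac)
  qed
  ultimately show ?case by blast
qed

text \<open>Multiplied by the Vandermonde product and by a power of the product of the variables, the symmetrized
  sum becomes a polynomial function. It is antisymmetric, since the sum is symmetric, hence it vanishes
  on all diagonals and the Vandermonde product divides it.\<close>
lemma hl_sum_laurent:
  assumes A: "finite A"
  shows "\<exists>K g. poly_fun g \<and>
    (\<forall>z. inj_on z A \<longrightarrow> (\<forall>i\<in>A. z i \<noteq> 0) \<longrightarrow> (\<Prod>i\<in>A. z i) ^ K * hl_sum t ls A z = g z)"
proof -
  define K where "K = nat (\<Sum>l\<in>set ls. \<bar>l\<bar>)"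
  have K: "\<forall>l\<in>set ls. 0 \<le> l + int K"
  proof
    fix l assume "l \<in> set ls"
    then have "\<bar>l\<bar> \<le> (\<Sum>l\<in>set ls. \<bar>l\<bar>)" by (intro member_le_sum) auto
    then show "0 \<le> l + int K" unfolding K_def by linarith
  qed
  obtain q where q: "poly_fun q" "\<And>z. inj_on z A \<Longrightarrow> \<forall>i\<in>A. z i \<noteq> 0 \<Longrightarrow>
    vandermonde A z * (\<Prod>i\<in>A. z i) ^ K * hl_sum t ls A z = q z"
    using hl_sum_numerator[OF A K] by blast
  have vanish: "q z = 0" if ij: "(i, j) \<in> {(i, j). i \<in> A \<and> j \<in> A \<and> i < j}" and eq: "z i = z j" for i j z
  proof -
    let ?\<tau> = "Transposition.transpose i j"
    have perm: "?\<tau> permutes A" using ij by (auto intro: permutes_swap_id)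
    have poly: "poly_fun (\<lambda>z. q z + q (z \<circ> ?\<tau>))"
      unfolding o_def by (rule poly_fun_add[OF q(1) poly_fun_reindex[OF q(1)]])
    have "q z + q (z \<circ> ?\<tau>) = 0" for z
    proof (rule poly_fun_eq_0[OF poly A])
      fix z :: "nat \<Rightarrow> complex" assume z: "inj_on z A" "\<And>i. i \<in> A \<Longrightarrow> z i \<noteq> 0"
      have inj: "inj_on ?\<tau> A" "?\<tau> ` A = A"
        using permutes_inj_on[OF perm] permutes_image[OF perm] by auto
      have "inj_on (z \<circ> ?\<tau>) A" using z(1) inj by (intro comp_inj_on) auto
      moreover have "\<forall>i\<in>A. (z \<circ> ?\<tau>) i \<noteq> 0" using z(2) inj(2) by fastforce
      ultimately have "q (z \<circ> ?\<tau>) = vandermonde A (z \<circ> ?\<tau>) * (\<Prod>i\<in>A. (z \<circ> ?\<tau>) i) ^ K * hl_sum t ls A (z \<circ> ?\<tau>)"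
        by (rule q(2)[symmetric])
      also have "(\<Prod>i\<in>A. (z \<circ> ?\<tau>) i) = (\<Prod>i\<in>A. z i)"
        using prod.permute[OF perm, of z] by simp
      also have "hl_sum t ls A (z \<circ> ?\<tau>) = hl_sum t ls A z"
        using hl_sum_image[OF inj(1), of t ls z] inj(2) by simp
      also have "vandermonde A (z \<circ> ?\<tau>) = - vandermonde A z"
        using ij by (intro vandermonde_swap A) auto
      finally show "q z + q (z \<circ> ?\<tau>) = 0" using q(2)[of z] z by (simp add: o_def)
    qed
    from this[of z] have "q z + q (z \<circ> ?\<tau>) = 0" .
    moreover have "z \<circ> ?\<tau> = z" using eq by (auto simp: Transposition.transpose_def)
    ultimately show ?thesis by simp
  qed
  obtain g where g: "poly_fun g" "\<And>z. q z = vandermonde A z * g z"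
    using poly_fun_divide_differences[OF q(1) A order_refl] vanish unfolding vandermonde_def by blast
  have "(\<Prod>i\<in>A. z i) ^ K * hl_sum t ls A z = g z" if "inj_on z A" "\<forall>i\<in>A. z i \<noteq> 0" for z
    using q(2)[OF that] g(2)[of z] vandermonde_nonzero[OF A that(1)] by (simp add: mult.assoc)
  with g(1) show ?thesis by blast
qed

text \<open>The bound that makes the integrals of the symmetrized sum converge. The lower limit \<open>1/2\<close> leaves room for
  variables that are moved slightly inside the unit circle.\<close>
lemma hl_sum_bounded:
  assumes A: "finite A"
  shows "\<exists>C. \<forall>z. inj_on z A \<longrightarrow> (\<forall>i\<in>A. 1/2 \<le> norm (z i) \<and> norm (z i) \<le> 1) \<longrightarrow> norm (hl_sum t ls A z) \<le> C"
proof -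
  obtain K g where g: "poly_fun g" "\<And>z. inj_on z A \<Longrightarrow> \<forall>i\<in>A. z i \<noteq> 0 \<Longrightarrow>
      (\<Prod>i\<in>A. z i) ^ K * hl_sum t ls A z = g z"
    using hl_sum_laurent[OF A] by blast
  obtain C where C: "\<And>z. \<forall>i. norm (z i) \<le> 1 \<Longrightarrow> norm (g z) \<le> C"
    using poly_fun_bounded[OF g(1)] by blast
  have "norm (hl_sum t ls A z) \<le> C / ((1/2) ^ card A) ^ K"
    if inj: "inj_on z A" and nz: "\<forall>i\<in>A. 1/2 \<le> norm (z i) \<and> norm (z i) \<le> 1" for z
  proof -
    define z' where "z' i = (if i \<in> A then z i else 0)" for i
    have "inj_on z' A" using inj by (simp add: z'_def inj_on_def)
    moreover have "\<forall>i\<in>A. z' i \<noteq> 0" using nz by (auto simp: z'_def)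
    ultimately have "(\<Prod>i\<in>A. z' i) ^ K * hl_sum t ls A z' = g z'" by (rule g(2))
    moreover have "hl_sum t ls A z' = hl_sum t ls A z" "(\<Prod>i\<in>A. z' i) = (\<Prod>i\<in>A. z i)"
      by (auto simp: z'_def intro!: hl_sum_cong prod.cong)
    moreover have "norm (g z') \<le> C" using nz by (intro C) (auto simp: z'_def)
    ultimately have le: "norm (\<Prod>i\<in>A. z i) ^ K * norm (hl_sum t ls A z) \<le> C"
      by (simp add: norm_mult[symmetric] norm_power[symmetric])
    have "(1/2) ^ card A = (\<Prod>i\<in>A. 1/2 :: real)" by simp
    also have "\<dots> \<le> (\<Prod>i\<in>A. norm (z i))" using nz by (intro prod_mono) auto
    finally have "((1/2) ^ card A) ^ K \<le> norm (\<Prod>i\<in>A. z i) ^ K"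
      by (intro power_mono) (auto simp: prod_norm)
    then have "((1/2) ^ card A) ^ K * norm (hl_sum t ls A z) \<le> C"
      using le by (meson mult_right_mono norm_ge_zero order_trans)
    then show ?thesis by (simp add: field_simps)
  qed
  then show ?thesis by blast
qed

section \<open>Integrating out one pair of variables\<close>

text \<open>The first block of variables is moved to the circle of radius \<open>r\<close>. For \<open>r < 1\<close> no variable of the first
  block meets one of the second, so the individual summands have no poles between the two blocks.\<close>
definition scaled :: "real \<Rightarrow> nat set \<Rightarrow> (nat \<Rightarrow> complex) \<Rightarrow> nat \<Rightarrow> complex" where
  "scaled r X z = (\<lambda>i. if i \<in> X then of_real r * z i else z i)"

text \<open>The unnormalized integral without its factorials and with \<open>v\<^sub>\<lambda> P\<^sub>\<lambda>\<close> in place of \<open>P\<^sub>\<lambda>\<close>. Only the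
  symmetrized sum is evaluated at the scaled variables: the weight depends on ratios within a block, so scaling does not change it.\<close>
definition hl_int :: "complex \<Rightarrow> real \<Rightarrow> nat set \<Rightarrow> nat set \<Rightarrow> int list \<Rightarrow> complex" where
  "hl_int t r X Y ls = (LINT z|torus (X \<union> Y).
     hl_sum t ls (X \<union> Y) (scaled r X z) * (torus_weight t X z * torus_weight t Y z))"

lemma hl_sum_measurable:
  "(\<And>i. i \<in> A \<Longrightarrow> (\<lambda>x. w x i) \<in> borel_measurable M) \<Longrightarrow> (\<lambda>x. hl_sum t ls A (w x)) \<in> borel_measurable M"
proof (induction ls arbitrary: A)
  case (Cons l ls)
  show ?case
    unfolding hl_sum.simps cross_def using Cons
    by (intro borel_measurable_sum borel_measurable_times borel_measurable_prod borel_measurable_powi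
        borel_measurable_divide borel_measurable_diff borel_measurable_const) auto
qed simp

lemma hl_res_measurable:
  "(\<And>i. i \<in> A \<Longrightarrow> (\<lambda>x. w x i) \<in> borel_measurable M) \<Longrightarrow> u \<in> borel_measurable M \<Longrightarrow>
    (\<lambda>x. hl_res t k ls A (w x) (u x)) \<in> borel_measurable M"
proof (induction ls arbitrary: A)
  case (Cons l ls)
  show ?case
    unfolding hl_res.simps cross_def using Cons
    by (intro borel_measurable_add borel_measurable_sum borel_measurable_times borel_measurable_prod
        borel_measurable_powi borel_measurable_inverse borel_measurable_power hl_sum_measurable
        borel_measurable_divide borel_measurable_diff borel_measurable_const) auto
qed simp

lemma hl_res_cong:
  "(\<And>i. i \<in> A \<Longrightarrow> z i = z' i) \<Longrightarrow> hl_res t k ls A z u = hl_res t k ls A z' u"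
proof (induction ls arbitrary: A)
  case (Cons l ls)
  have "(\<Prod>b\<in>A - {a}. cross t (z a) (z b)) = (\<Prod>b\<in>A - {a}. cross t (z' a) (z' b))" if "a \<in> A" for a
    using Cons.prems that by (intro prod.cong) auto
  moreover have "hl_res t k ls (A - {a}) z u = hl_res t k ls (A - {a}) z' u" for a
    using Cons.prems by (intro Cons.IH) auto
  moreover have "hl_sum t ls A z = hl_sum t ls A z'" using Cons.prems by (intro hl_sum_cong)
  ultimately show ?case
    using Cons.prems by (simp cong: sum.cong prod.cong)
qed simp

lemma one_minus_neq_0:
  assumes "norm t < 1" "norm u \<le> norm b" "b \<noteq> 0"
  shows "1 - t * u * inverse b \<noteq> (0::complex)"
proof
  assume "1 - t * u * inverse b = 0"
  then have "norm (t * u * inverse b) = 1" by (metis eq_iff_diff_eq_0 norm_one)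
  moreover have "norm u / norm b \<le> 1" using assms by (simp add: divide_le_eq_1_pos)
  then have "norm (t * u * inverse b) \<le> norm t * 1"
    unfolding norm_mult norm_inverse mult.assoc divide_inverse by (intro mult_left_mono) auto
  ultimately show False using assms by simp
qed

lemma hl_res_holomorphic:
  assumes "norm t < 1" "\<And>b. b \<in> A \<Longrightarrow> r \<le> norm (w b)" "0 < r"
  shows "(\<lambda>u. hl_res t k ls A w (of_real r * u)) holomorphic_on cball 0 1"
  using assms(2)
proof (induction ls arbitrary: A)
  case (Cons l ls)
  have "1 - t * (of_real r * u) * inverse (w b) \<noteq> 0" if "b \<in> A" "u \<in> cball 0 1" for b u
    using that assms(1,3) Cons.prems[OF that(1)]
    by (intro one_minus_neq_0) (auto simp: norm_mult intro: order_trans[OF mult_left_le])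
  then show ?case
    unfolding hl_res.simps using Cons.prems
    by (intro holomorphic_intros Cons.IH) auto
qed simp

lemma scaled_inj:
  assumes "inj_on z I" "\<And>i. i \<in> I \<Longrightarrow> norm (z i) = 1" "0 < r" "r \<le> 1"
  shows "inj_on (scaled r X z) I"
proof (rule inj_onI)
  fix i j assume ij: "i \<in> I" "j \<in> I" and eq: "scaled r X z i = scaled r X z j"
  have "z i = z j"
  proof (cases "r = 1")
    case True
    then show ?thesis using eq by (simp add: scaled_def split: if_splits)
  next
    case False
    from eq have "norm (scaled r X z i) = norm (scaled r X z j)" by simp
    then have "i \<in> X \<longleftrightarrow> j \<in> X"
      using ij assms False by (simp add: scaled_def norm_mult split: if_splits)
    then show ?thesis using eq assms(3) by (simp add: scaled_def split: if_splits)
  qed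
  then show "i = j" using assms(1) ij by (simp add: inj_on_def)
qed

lemma norm_scaled: "norm (z i) = 1 \<Longrightarrow> 0 < r \<Longrightarrow> norm (scaled r X z i) = (if i \<in> X then r else 1)"
  by (simp add: scaled_def norm_mult)

lemma scaled_measurable: "i \<in> I \<Longrightarrow> (\<lambda>z. scaled r X z i) \<in> borel_measurable (torus I)"
  unfolding scaled_def by (cases "i \<in> X") (auto intro!: borel_measurable_times component_measurable)

lemma hl_sum_scaled_bounded:
  assumes "finite A"
  shows "\<exists>C. \<forall>r z. 1/2 \<le> r \<longrightarrow> r \<le> 1 \<longrightarrow> inj_on z A \<longrightarrow> (\<forall>i\<in>A. norm (z i) = 1) \<longrightarrow>
    norm (hl_sum t ls A (scaled r X z)) \<le> C"
proof -
  obtain C where C: "\<And>z. inj_on z A \<Longrightarrow> \<forall>i\<in>A. 1/2 \<le> norm (z i) \<and> norm (z i) \<le> 1 \<Longrightarrow> norm (hl_sum t ls A z) \<le> C"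
    using hl_sum_bounded[OF assms] by blast
  have "norm (hl_sum t ls A (scaled r X z)) \<le> C"
    if "1/2 \<le> r" "r \<le> 1" "inj_on z A" "\<forall>i\<in>A. norm (z i) = 1" for r z
    using that by (intro C scaled_inj) (auto simp: norm_scaled)
  then show ?thesis by blast
qed

lemma tame_hl_sum:
  assumes "finite I" "A \<subseteq> I" "1/2 \<le> r" "r \<le> 1"
  shows "tame I (\<lambda>z. hl_sum t ls A (scaled r X z))"
proof -
  have "finite A" using assms finite_subset by blast
  then obtain C where C: "\<And>r z. 1/2 \<le> r \<Longrightarrow> r \<le> 1 \<Longrightarrow> inj_on z A \<Longrightarrow> \<forall>i\<in>A. norm (z i) = 1 \<Longrightarrow>
    norm (hl_sum t ls A (scaled r X z)) \<le> C"
    using hl_sum_scaled_bounded by blast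
  show ?thesis
    using assms(1)
  proof (rule tame_boundI)
    show "(\<lambda>z. hl_sum t ls A (scaled r X z)) \<in> borel_measurable (torus I)"
      using assms(2) by (intro hl_sum_measurable scaled_measurable) auto
    show "norm (hl_sum t ls A (scaled r X z)) \<le> C" if "inj_on z I" "\<And>i. i \<in> I \<Longrightarrow> norm (z i) = 1" for z
      using that assms by (intro C) (auto intro: inj_on_subset)
  qed
qed

lemma dens_measurable:
  assumes [measurable]: "f \<in> borel_measurable M" "g \<in> borel_measurable M"
  shows "(\<lambda>x. dens t (f x) (g x)) \<in> borel_measurable M"
  unfolding dens_def by measurable

lemma cross_measurable:
  assumes [measurable]: "f \<in> borel_measurable M" "g \<in> borel_measurable M"
  shows "(\<lambda>x. cross t (f x) (g x)) \<in> borel_measurable M"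
  unfolding cross_def by measurable

lemma torus_weight_cong:
  "(\<And>i. i \<in> I \<Longrightarrow> z i = z' i) \<Longrightarrow> torus_weight t I z = torus_weight t I z'"
  unfolding torus_weight_def by (intro prod.cong) auto

lemma cross_scale: "c \<noteq> 0 \<Longrightarrow> cross t (c * a) (c * b) = cross t a b"
  unfolding cross_def by (metis mult_divide_mult_cancel_left mult.left_commute right_diff_distrib)

lemma dens_scale: "c \<noteq> 0 \<Longrightarrow> dens t (c * a) (c * b) = dens t a b"
  unfolding dens_def by (simp add: field_simps)

lemma dens_holomorphic:
  assumes "norm t < 1" "0 < r" "r \<le> 1" "norm b = 1"
  shows "(\<lambda>u. dens t (of_real r * u) b) holomorphic_on cball 0 1"
proof -
  have "1 - t * (of_real r * u) * inverse b \<noteq> 0" if "u \<in> cball 0 1" for u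
    using that assms by (intro one_minus_neq_0) (auto simp: norm_mult intro!: mult_le_one)
  then show ?thesis unfolding dens_def by (intro holomorphic_intros) auto
qed

lemma norm_cross_le:
  assumes "norm t < 1" "norm a \<le> 1" "norm b \<le> 1" "d \<le> norm (a - b)" "0 < d"
  shows "norm (cross t a b) \<le> 2 / d"
proof -
  have "norm (t * b) \<le> 1" unfolding norm_mult using assms by (intro mult_le_one) auto
  then have "norm (a - t * b) \<le> 2" using norm_triangle_ineq4[of a "t * b"] assms by simp
  then show ?thesis unfolding cross_def norm_divide using assms by (intro frac_le) auto
qed

text \<open>The regularized setting in which the variables are integrated out term by term.\<close>
locale scaled_blocks =
  fixes t :: complex and r :: real and X Y :: "nat set"
  assumes t: "norm t < 1" and r: "1/2 \<le> r" "r < 1"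
    and fin: "finite X" "finite Y" and disj: "X \<inter> Y = {}"
begin

abbreviation sc :: "(nat \<Rightarrow> complex) \<Rightarrow> nat \<Rightarrow> complex" where "sc \<equiv> scaled r X"

text \<open>The part of the integrand in which the variable \<open>a\<close> stands first, for \<open>a\<close> in the first block
  (\<open>lead_x\<close>) and in the second (\<open>lead_y\<close>), after the cancellation of \<open>torus_weight_cross\<close>. In this form each
  part is bounded.\<close>
definition lead_x :: "nat \<Rightarrow> int list \<Rightarrow> nat \<Rightarrow> (nat \<Rightarrow> complex) \<Rightarrow> complex" where
  "lead_x k ls a z = ((of_real r * z a) ^ k * (\<Prod>b\<in>X - {a}. dens t (z a) (z b)) * (\<Prod>y\<in>Y. cross t (of_real r * z a) (z y))) *
     (hl_sum t ls (X \<union> Y - {a}) (sc z) * (torus_weight t (X - {a}) z * torus_weight t Y z))"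

definition lead_y :: "nat \<Rightarrow> int list \<Rightarrow> nat \<Rightarrow> (nat \<Rightarrow> complex) \<Rightarrow> complex" where
  "lead_y k ls a z = (z a ^ k * (\<Prod>b\<in>Y - {a}. dens t (z a) (z b)) * (\<Prod>x\<in>X. cross t (z a) (of_real r * z x))) *
     (hl_sum t ls (X \<union> Y - {a}) (sc z) * (torus_weight t X z * torus_weight t (Y - {a}) z))"

lemma gap:
  fixes u v :: complex
  assumes "norm u = 1" "norm v = 1"
  shows "1 - r \<le> norm (of_real r * u - v)" "1 - r \<le> norm (v - of_real r * u)"
  using assms norm_triangle_ineq2[of v "of_real r * u"] r norm_minus_commute[of v "of_real r * u"]
  by (auto simp: norm_mult)

lemma gt: "norm a = 1 \<Longrightarrow> norm b = 1 \<Longrightarrow> a \<noteq> t * b"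
  using t by (auto simp: norm_mult)

lemma tame_lead_x: assumes "a \<in> X" shows "tame (X \<union> Y) (lead_x k ls a)"
  unfolding lead_x_def
proof (rule tame_mult)
  show "tame (X \<union> Y) (\<lambda>z. (of_real r * z a) ^ k * (\<Prod>b\<in>X - {a}. dens t (z a) (z b)) * (\<Prod>y\<in>Y. cross t (of_real r * z a) (z y)))"
  proof (rule tame_boundI)
    show "(\<lambda>z. (of_real r * z a) ^ k * (\<Prod>b\<in>X - {a}. dens t (z a) (z b)) * (\<Prod>y\<in>Y. cross t (of_real r * z a) (z y)))
        \<in> borel_measurable (torus (X \<union> Y))"
      using assms by (intro borel_measurable_times borel_measurable_power borel_measurable_prod dens_measurable
          cross_measurable component_measurable borel_measurable_const) auto
    fix z :: "nat \<Rightarrow> complex" assume z: "\<And>i. i \<in> X \<union> Y \<Longrightarrow> norm (z i) = 1"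
    have "norm ((of_real r * z a) ^ k) \<le> 1"
      unfolding norm_power using r z assms by (intro power_le_one) (auto simp: norm_mult)
    moreover have "norm (\<Prod>b\<in>X - {a}. dens t (z a) (z b)) \<le> (\<Prod>b\<in>X - {a}. 2 / (1 - norm t))"
      using t z assms by (intro norm_prod_le_const norm_dens_le) auto
    moreover have "norm (\<Prod>y\<in>Y. cross t (of_real r * z a) (z y)) \<le> (\<Prod>y\<in>Y. 2 / (1 - r))"
      using t z r assms gap(1) by (intro norm_prod_le_const norm_cross_le) (auto simp: norm_mult)
    ultimately show "norm ((of_real r * z a) ^ k * (\<Prod>b\<in>X - {a}. dens t (z a) (z b)) * (\<Prod>y\<in>Y. cross t (of_real r * z a) (z y)))
      \<le> 1 * (\<Prod>b\<in>X - {a}. 2 / (1 - norm t)) * (\<Prod>y\<in>Y. 2 / (1 - r))"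
      unfolding norm_mult using t by (intro mult_mono) (auto intro!: prod_nonneg mult_nonneg_nonneg)
  qed (use fin in auto)
  show "tame (X \<union> Y) (\<lambda>z. hl_sum t ls (X \<union> Y - {a}) (sc z) * (torus_weight t (X - {a}) z * torus_weight t Y z))"
    using t r fin by (intro tame_mult tame_hl_sum tame_torus_weight) auto
qed

lemma tame_lead_y: assumes "a \<in> Y" shows "tame (X \<union> Y) (lead_y k ls a)"
  unfolding lead_y_def
proof (rule tame_mult)
  show "tame (X \<union> Y) (\<lambda>z. z a ^ k * (\<Prod>b\<in>Y - {a}. dens t (z a) (z b)) * (\<Prod>x\<in>X. cross t (z a) (of_real r * z x)))"
  proof (rule tame_boundI)
    show "(\<lambda>z. z a ^ k * (\<Prod>b\<in>Y - {a}. dens t (z a) (z b)) * (\<Prod>x\<in>X. cross t (z a) (of_real r * z x)))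
        \<in> borel_measurable (torus (X \<union> Y))"
      using assms by (intro borel_measurable_times borel_measurable_power borel_measurable_prod dens_measurable
          cross_measurable component_measurable borel_measurable_const) auto
    fix z :: "nat \<Rightarrow> complex" assume z: "\<And>i. i \<in> X \<union> Y \<Longrightarrow> norm (z i) = 1"
    have "norm (z a ^ k) \<le> 1"
      unfolding norm_power using r z assms by (intro power_le_one) auto
    moreover have "norm (\<Prod>b\<in>Y - {a}. dens t (z a) (z b)) \<le> (\<Prod>b\<in>Y - {a}. 2 / (1 - norm t))"
      using t z assms by (intro norm_prod_le_const norm_dens_le) auto
    moreover have "norm (\<Prod>x\<in>X. cross t (z a) (of_real r * z x)) \<le> (\<Prod>x\<in>X. 2 / (1 - r))"
      using t z r assms gap(2) by (intro norm_prod_le_const norm_cross_le) (auto simp: norm_mult)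
    ultimately show "norm (z a ^ k * (\<Prod>b\<in>Y - {a}. dens t (z a) (z b)) * (\<Prod>x\<in>X. cross t (z a) (of_real r * z x)))
      \<le> 1 * (\<Prod>b\<in>Y - {a}. 2 / (1 - norm t)) * (\<Prod>x\<in>X. 2 / (1 - r))"
      unfolding norm_mult using t by (intro mult_mono) (auto intro!: prod_nonneg mult_nonneg_nonneg)
  qed (use fin in auto)
  show "tame (X \<union> Y) (\<lambda>z. hl_sum t ls (X \<union> Y - {a}) (sc z) * (torus_weight t X z * torus_weight t (Y - {a}) z))"
    using t r fin by (intro tame_mult tame_hl_sum tame_torus_weight) auto
qed

lemma integrand_Cons:
  assumes inj: "inj_on z (X \<union> Y)" and z: "\<And>i. i \<in> X \<union> Y \<Longrightarrow> norm (z i) = 1"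
  shows "hl_sum t (int k # ls) (X \<union> Y) (sc z) * (torus_weight t X z * torus_weight t Y z) =
    (\<Sum>a\<in>X. lead_x k ls a z) + (\<Sum>a\<in>Y. lead_y k ls a z)"
proof -
  have nz: "z i \<noteq> 0" if "i \<in> X \<union> Y" for i using z[OF that] by auto
  have gt': "z a \<noteq> t * z b" if "a \<in> X \<union> Y" "b \<in> X \<union> Y" for a b
    using gt[OF z[OF that(1)] z[OF that(2)]] by simp
  have scX: "sc z a = of_real r * z a" if "a \<in> X" for a using that by (simp add: scaled_def)
  have scY: "sc z a = z a" if "a \<in> Y" for a using that disj by (auto simp: scaled_def)
  let ?h = "\<lambda>a. sc z a powi int k * (\<Prod>b\<in>X \<union> Y - {a}. cross t (sc z a) (sc z b)) * hl_sum t ls (X \<union> Y - {a}) (sc z)"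
  have x: "?h a * (torus_weight t X z * torus_weight t Y z) = lead_x k ls a z" if a: "a \<in> X" for a
  proof -
    have "X \<union> Y - {a} = (X - {a}) \<union> Y" using a disj by auto
    then have "(\<Prod>b\<in>X \<union> Y - {a}. cross t (sc z a) (sc z b)) =
        (\<Prod>b\<in>X - {a}. cross t (sc z a) (sc z b)) * (\<Prod>b\<in>Y. cross t (sc z a) (sc z b))"
      using fin disj by (simp only:) (intro prod.union_disjoint; blast)
    also have "(\<Prod>b\<in>X - {a}. cross t (sc z a) (sc z b)) = (\<Prod>b\<in>X - {a}. cross t (z a) (z b))"
      using a r by (intro prod.cong) (auto simp: scX cross_scale)
    also have "(\<Prod>b\<in>Y. cross t (sc z a) (sc z b)) = (\<Prod>y\<in>Y. cross t (of_real r * z a) (z y))"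
      using a by (intro prod.cong) (auto simp: scX scY)
    finally have 1: "(\<Prod>b\<in>X \<union> Y - {a}. cross t (sc z a) (sc z b)) =
      (\<Prod>b\<in>X - {a}. cross t (z a) (z b)) * (\<Prod>y\<in>Y. cross t (of_real r * z a) (z y))" .
    have 2: "torus_weight t X z * (\<Prod>b\<in>X - {a}. cross t (z a) (z b)) =
      (\<Prod>b\<in>X - {a}. dens t (z a) (z b)) * torus_weight t (X - {a}) z"
    proof (rule torus_weight_cross[OF fin(1) a])
      fix b assume "b \<in> X - {a}"
      then show "z a \<noteq> z b \<and> z a \<noteq> t * z b"
        using inj a gt'[of a b] by (auto simp: inj_on_def)
    qed (use nz in auto)
    have "p * (c * d) * h * (w * v) = p * e * d * (h * (w' * v))" if "w * c = e * w'" for p c d h w v e w' :: complex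
      using that by algebra
    from this[OF 2] show ?thesis unfolding lead_x_def 1 unfolding scX[OF a] power_int_of_nat .
  qed
  have y: "?h a * (torus_weight t X z * torus_weight t Y z) = lead_y k ls a z" if a: "a \<in> Y" for a
  proof -
    have "X \<union> Y - {a} = (Y - {a}) \<union> X" using a disj by auto
    then have "(\<Prod>b\<in>X \<union> Y - {a}. cross t (sc z a) (sc z b)) =
        (\<Prod>b\<in>Y - {a}. cross t (sc z a) (sc z b)) * (\<Prod>b\<in>X. cross t (sc z a) (sc z b))"
      using fin disj by (simp only:) (intro prod.union_disjoint; blast)
    also have "(\<Prod>b\<in>Y - {a}. cross t (sc z a) (sc z b)) = (\<Prod>b\<in>Y - {a}. cross t (z a) (z b))"
      using a by (intro prod.cong) (auto simp: scY)
    also have "(\<Prod>b\<in>X. cross t (sc z a) (sc z b)) = (\<Prod>x\<in>X. cross t (z a) (of_real r * z x))"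
      using a by (intro prod.cong) (auto simp: scX scY)
    finally have 1: "(\<Prod>b\<in>X \<union> Y - {a}. cross t (sc z a) (sc z b)) =
      (\<Prod>b\<in>Y - {a}. cross t (z a) (z b)) * (\<Prod>x\<in>X. cross t (z a) (of_real r * z x))" .
    have 2: "torus_weight t Y z * (\<Prod>b\<in>Y - {a}. cross t (z a) (z b)) =
      (\<Prod>b\<in>Y - {a}. dens t (z a) (z b)) * torus_weight t (Y - {a}) z"
    proof (rule torus_weight_cross[OF fin(2) a])
      fix b assume "b \<in> Y - {a}"
      then show "z a \<noteq> z b \<and> z a \<noteq> t * z b"
        using inj a gt'[of a b] by (auto simp: inj_on_def)
    qed (use nz in auto)
    have "p * (c * d) * h * (v * w) = p * e * d * (h * (v * w'))" if "w * c = e * w'" for p c d h w v e w' :: complex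
      using that by algebra
    from this[OF 2] show ?thesis unfolding lead_y_def 1 unfolding scY[OF a] power_int_of_nat .
  qed
  show ?thesis
    unfolding hl_sum.simps sum_distrib_right
    using fin disj x y by (simp add: sum.union_disjoint)
qed

lemma hl_int_Cons:
  "hl_int t r X Y (int k # ls) =
    (\<Sum>a\<in>X. integral\<^sup>L (torus (X \<union> Y)) (lead_x k ls a)) + (\<Sum>a\<in>Y. integral\<^sup>L (torus (X \<union> Y)) (lead_y k ls a))"
proof -
  have int: "integrable (torus (X \<union> Y)) (lead_x k ls a)" if "a \<in> X" for a
    using that by (intro tame_integrable tame_lead_x)
  have int': "integrable (torus (X \<union> Y)) (lead_y k ls a)" if "a \<in> Y" for a
    using that by (intro tame_integrable tame_lead_y)
  have "hl_int t r X Y (int k # ls) =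
      (LINT z|torus (X \<union> Y). (\<Sum>a\<in>X. lead_x k ls a z) + (\<Sum>a\<in>Y. lead_y k ls a z))"
    unfolding hl_int_def
  proof (rule tame_cong(2))
    show "tame (X \<union> Y) (\<lambda>z. hl_sum t (int k # ls) (X \<union> Y) (sc z) * (torus_weight t X z * torus_weight t Y z))"
      using t r fin by (intro tame_mult tame_hl_sum tame_torus_weight) auto
    show "(\<lambda>z. (\<Sum>a\<in>X. lead_x k ls a z) + (\<Sum>a\<in>Y. lead_y k ls a z)) \<in> borel_measurable (torus (X \<union> Y))"
      using tame_lead_x tame_lead_y by (intro borel_measurable_add borel_measurable_sum) (auto simp: tame_def)
  qed (use fin integrand_Cons in auto)
  also have "\<dots> = (\<Sum>a\<in>X. integral\<^sup>L (torus (X \<union> Y)) (lead_x k ls a)) + (\<Sum>a\<in>Y. integral\<^sup>L (torus (X \<union> Y)) (lead_y k ls a))"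
    using int int' by (simp add: Bochner_Integration.integral_add Bochner_Integration.integral_sum)
  finally show ?thesis .
qed

end

context scaled_blocks
begin

lemma cross_holomorphic:
  assumes "norm b = 1"
  shows "(\<lambda>u. cross t (of_real r * u) b) holomorphic_on cball 0 1"
proof -
  have "of_real r * u - b \<noteq> 0" if "u \<in> cball 0 1" for u
  proof
    assume "of_real r * u - b = 0"
    then have "norm (of_real r * u) = 1" using assms by simp
    moreover have "norm (of_real r * u) \<le> r"
      using that r by (auto simp: norm_mult intro: mult_left_le)
    ultimately show False using r by simp
  qed
  then show ?thesis unfolding cross_def by (intro holomorphic_intros) auto
qed

text \<open>The variables of the second block lie outside the circle of radius \<open>r\<close>, so the integrand is
  holomorphic in the first variable up to the unit circle. It vanishes at the origin because of the
  positive exponent.\<close>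
lemma integral_lead_x:
  assumes a: "a \<in> X" and k: "0 < k"
  shows "integral\<^sup>L (torus (X \<union> Y)) (lead_x k ls a) = 0"
proof -
  have "integral\<^sup>L (torus (X \<union> Y)) (lead_x k ls a) = integral\<^sup>L (torus (X \<union> Y - {a})) (\<lambda>z. 0)"
  proof (rule torus_integral_insert[OF tame_lead_x[OF a]])
    fix z :: "nat \<Rightarrow> complex" assume z: "\<And>j. j \<in> X \<union> Y - {a} \<Longrightarrow> norm (z j) = 1"
    define h where "h u = (of_real r * u) ^ k * (\<Prod>b\<in>X - {a}. dens t u (z b)) * (\<Prod>y\<in>Y. cross t (of_real r * u) (z y))" for u
    have aY: "a \<notin> Y" using a disj by auto
    have eq: "lead_x k ls a (z(a := u)) = h u *
       (hl_sum t ls (X \<union> Y - {a}) (sc z) * (torus_weight t (X - {a}) z * torus_weight t Y z))" for u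
    proof -
      have "hl_sum t ls (X \<union> Y - {a}) (sc (z(a := u))) = hl_sum t ls (X \<union> Y - {a}) (sc z)"
        by (intro hl_sum_cong) (auto simp: scaled_def)
      moreover have "torus_weight t (X - {a}) (z(a := u)) = torus_weight t (X - {a}) z"
        "torus_weight t Y (z(a := u)) = torus_weight t Y z"
        using aY by - (rule torus_weight_cong, auto split: if_splits)+
      moreover have "(\<Prod>b\<in>X - {a}. dens t u ((z(a := u)) b)) = (\<Prod>b\<in>X - {a}. dens t u (z b))"
        "(\<Prod>y\<in>Y. cross t (of_real r * u) ((z(a := u)) y)) = (\<Prod>y\<in>Y. cross t (of_real r * u) (z y))"
        using aY by (auto intro!: prod.cong)
      ultimately show ?thesis by (simp add: lead_x_def h_def)
    qed
    have "h holomorphic_on cball 0 1"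
      unfolding h_def using z aY t dens_holomorphic[of t 1]
      by (intro holomorphic_intros cross_holomorphic) auto
    moreover have "h \<in> borel_measurable borel"
      unfolding h_def by (intro borel_measurable_times borel_measurable_power borel_measurable_prod dens_measurable
          cross_measurable borel_measurable_const) auto
    ultimately have "(LINT u|circle_measure. h u) = h 0" by (rule circle_mean_value)
    then show "(LINT u|circle_measure. lead_x k ls a (z(a := u))) = 0"
      using k unfolding eq by (simp add: h_def power_0_left)
  qed (use fin a in auto)
  then show ?thesis by simp
qed

text \<open>What the pole of the leading variable \<open>y\<^sub>a\<close> at \<open>r x\<^sub>c\<close> leaves behind: \<open>x\<^sub>c\<close> has inherited the exponent
  \<open>k\<close> and the weight factors of \<open>y\<^sub>a\<close>, while the sum still contains \<open>x\<^sub>c\<close> as a variable.\<close>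
definition pair_term :: "nat \<Rightarrow> int list \<Rightarrow> nat \<Rightarrow> nat \<Rightarrow> (nat \<Rightarrow> complex) \<Rightarrow> complex" where
  "pair_term k ls a c z =
    ((of_real r * z c) ^ k * (\<Prod>l\<in>X - {c}. dens t (z c) (z l)) * (\<Prod>b\<in>Y - {a}. dens t (of_real r * z c) (z b))) *
    (hl_sum t ls (X \<union> Y - {a}) (sc z) * (torus_weight t (X - {c}) z * torus_weight t (Y - {a}) z))"

lemma tame_pair_term:
  assumes "c \<in> X" "a \<in> Y" shows "tame (X \<union> Y - {a}) (pair_term k ls a c)"
  unfolding pair_term_def
proof (rule tame_mult)
  have c: "c \<in> X \<union> Y - {a}" using assms disj by auto
  show "tame (X \<union> Y - {a}) (\<lambda>z. (of_real r * z c) ^ k * (\<Prod>l\<in>X - {c}. dens t (z c) (z l)) *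
      (\<Prod>b\<in>Y - {a}. dens t (of_real r * z c) (z b)))"
  proof (rule tame_boundI)
    show "(\<lambda>z. (of_real r * z c) ^ k * (\<Prod>l\<in>X - {c}. dens t (z c) (z l)) *
        (\<Prod>b\<in>Y - {a}. dens t (of_real r * z c) (z b))) \<in> borel_measurable (torus (X \<union> Y - {a}))"
      using c assms disj by (intro borel_measurable_times borel_measurable_power borel_measurable_prod dens_measurable
          component_measurable borel_measurable_const) auto
    fix z :: "nat \<Rightarrow> complex" assume z: "\<And>i. i \<in> X \<union> Y - {a} \<Longrightarrow> norm (z i) = 1"
    have X: "norm (z l) = 1" if "l \<in> X" for l using that z assms disj by auto
    have "norm ((of_real r * z c) ^ k) \<le> 1"
      unfolding norm_power using r X assms by (intro power_le_one) (auto simp: norm_mult)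
    moreover have "norm (\<Prod>b\<in>X - {c}. dens t (z c) (z b)) \<le> (\<Prod>b\<in>X - {c}. 2 / (1 - norm t))"
      using t X assms by (intro norm_prod_le_const norm_dens_le) auto
    moreover have "norm (\<Prod>b\<in>Y - {a}. dens t (of_real r * z c) (z b)) \<le> (\<Prod>b\<in>Y - {a}. 2 / (1 - norm t))"
      using t r z X assms by (intro norm_prod_le_const norm_dens_le) (auto simp: norm_mult)
    ultimately show "norm ((of_real r * z c) ^ k * (\<Prod>l\<in>X - {c}. dens t (z c) (z l)) *
      (\<Prod>b\<in>Y - {a}. dens t (of_real r * z c) (z b)))
      \<le> 1 * (\<Prod>b\<in>X - {c}. 2 / (1 - norm t)) * (\<Prod>b\<in>Y - {a}. 2 / (1 - norm t))"
      unfolding norm_mult using t by (intro mult_mono) (auto intro!: prod_nonneg mult_nonneg_nonneg)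
  qed (use fin in auto)
  show "tame (X \<union> Y - {a}) (\<lambda>z. hl_sum t ls (X \<union> Y - {a}) (sc z) * (torus_weight t (X - {c}) z * torus_weight t (Y - {a}) z))"
    using t r fin assms disj by (intro tame_mult tame_hl_sum tame_torus_weight) auto
qed

text \<open>The partial fraction expansion writes the factors between \<open>y\<^sub>a\<close> and the first block as simple poles, and
  Cauchy's formula evaluates the remaining factors at each of them. The coefficients of the expansion have
  poles on the diagonals of the first block, which the weight of that block cancels.\<close>
lemma integral_lead_y:
  assumes a: "a \<in> Y" and k: "0 < k"
  shows "integral\<^sup>L (torus (X \<union> Y)) (lead_y k ls a) =
    (1 - t) * (\<Sum>c\<in>X. integral\<^sup>L (torus (X \<union> Y - {a})) (pair_term k ls a c))"
proof -
  let ?I = "X \<union> Y - {a}"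
  have aX: "a \<notin> X" using a disj by auto
  have "integral\<^sup>L (torus (X \<union> Y)) (lead_y k ls a) =
    integral\<^sup>L (torus ?I) (\<lambda>z. (1 - t) * (\<Sum>c\<in>X. pair_term k ls a c z))"
  proof (rule torus_integral_insert[OF tame_lead_y[OF a]])
    show "(\<lambda>z. (1 - t) * (\<Sum>c\<in>X. pair_term k ls a c z)) \<in> borel_measurable (torus ?I)"
      using tame_pair_term a by (intro borel_measurable_times borel_measurable_const borel_measurable_sum) (auto simp: tame_def)
    fix z :: "nat \<Rightarrow> complex" assume z: "\<And>j. j \<in> ?I \<Longrightarrow> norm (z j) = 1" and inj: "inj_on z ?I"
    have zX: "norm (z c) = 1" "z c \<noteq> 0" if "c \<in> X" for c
    proof -
      have "c \<in> ?I" using that aX by auto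
      then show "norm (z c) = 1" by (rule z)
      then show "z c \<noteq> 0" by auto
    qed
    define R where "R = hl_sum t ls ?I (sc z) * (torus_weight t X z * torus_weight t (Y - {a}) z)"
    define h where "h u = u ^ (k - 1) * (\<Prod>b\<in>Y - {a}. dens t u (z b))" for u
    define P where "P c = (\<Prod>l\<in>X - {c}. cross t (z c) (z l))" for c
    have eq: "lead_y k ls a (z(a := u)) = u * h u * (\<Prod>x\<in>X. cross t u (of_real r * z x)) * R" for u
    proof -
      have "hl_sum t ls ?I (sc (z(a := u))) = hl_sum t ls ?I (sc z)"
        by (intro hl_sum_cong) (auto simp: scaled_def)
      moreover have "torus_weight t (Y - {a}) (z(a := u)) = torus_weight t (Y - {a}) z"
        "torus_weight t X (z(a := u)) = torus_weight t X z"
        using aX by - (rule torus_weight_cong, auto split: if_splits)+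
      moreover have "(\<Prod>b\<in>Y - {a}. dens t u ((z(a := u)) b)) = (\<Prod>b\<in>Y - {a}. dens t u (z b))"
        "(\<Prod>x\<in>X. cross t u (of_real r * (z(a := u)) x)) = (\<Prod>x\<in>X. cross t u (of_real r * z x))"
        using aX by (auto intro!: prod.cong)
      moreover have "u ^ k = u * u ^ (k - 1)" using k by (cases k) auto
      ultimately show ?thesis by (simp add: lead_y_def h_def R_def)
    qed
    have holo: "h holomorphic_on cball 0 1"
      unfolding h_def using z t dens_holomorphic[of t 1] by (intro holomorphic_intros) auto
    have meas: "h \<in> borel_measurable borel"
      unfolding h_def by (intro borel_measurable_times borel_measurable_power borel_measurable_prod dens_measurable
          borel_measurable_const) auto
    have hu: "(\<lambda>u. u * h u) holomorphic_on cball 0 1" "(\<lambda>u. u * h u) \<in> borel_measurable borel"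
      using holo meas by (auto intro!: holomorphic_intros)
    note mean = circle_mean_value[OF hu]
    have small: "norm (of_real r * z c) < 1" if "c \<in> X" for c
      using that zX r by (simp add: norm_mult)
    note cauchy = circle_cauchy[OF holo meas small]
    let ?w = "\<lambda>c. of_real r * z c"
    have inj': "inj_on ?w X"
      using inj r aX by (auto simp: inj_on_def)
    have P': "(\<Prod>l\<in>X - {c}. cross t (?w c) (?w l)) = P c" for c
      unfolding P_def using r by (intro prod.cong) (auto simp: cross_scale)
    \<comment> \<open>Only the poles at \<open>u = r * z c\<close> lie inside the circle; the term without a pole vanishes at the origin.\<close>
    have "(LINT u|circle_measure. lead_y k ls a (z(a := u))) =
      (LINT u|circle_measure. (u * h u + (\<Sum>c\<in>X. ((1 - t) * (?w c * P c)) * (h u * (u / (u - ?w c))))) * R)"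
    proof (rule integral_cong_AE)
      show "AE u in circle_measure. lead_y k ls a (z(a := u)) =
          (u * h u + (\<Sum>c\<in>X. ((1 - t) * (?w c * P c)) * (h u * (u / (u - ?w c))))) * R"
        using AE_circle_norm
      proof eventually_elim
        case (elim u)
        have "u \<notin> ?w ` X" using elim small by force
        from lagrange_expansion[OF fin(1) inj' this]
        have L: "(\<Prod>x\<in>X. cross t u (?w x)) = 1 + (1 - t) * (\<Sum>c\<in>X. ?w c * P c / (u - ?w c))"
          by (simp add: P')
        show ?case
          unfolding eq L by (simp add: distrib_left sum_distrib_left mult_ac)
      qed
      show "(\<lambda>u. lead_y k ls a (z(a := u))) \<in> borel_measurable circle_measure"
        unfolding eq using meas
        by (intro borel_measurable_times borel_measurable_prod cross_measurable) auto
      show "(\<lambda>u. (u * h u + (\<Sum>c\<in>X. ((1 - t) * (?w c * P c)) * (h u * (u / (u - ?w c))))) * R) \<in> borel_measurable circle_measure"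
        using meas by (intro borel_measurable_times borel_measurable_add borel_measurable_sum
            borel_measurable_divide borel_measurable_diff) auto
    qed
    also have "\<dots> = (\<Sum>c\<in>X. (1 - t) * (?w c * P c) * h (?w c)) * R"
    proof -
      define F where "F c u = h u * (u / (u - ?w c))" for c u
      have "integrable circle_measure (F c)" "(LINT u|circle_measure. F c u) = h (?w c)" if "c \<in> X" for c
        using cauchy[OF that] unfolding F_def by auto
      then show ?thesis
        using mean unfolding F_def[symmetric]
        by (simp add: Bochner_Integration.integral_add Bochner_Integration.integral_sum)
    qed
    also have "\<dots> = (1 - t) * (\<Sum>c\<in>X. pair_term k ls a c z)"
      unfolding sum_distrib_left sum_distrib_right
    proof (rule sum.cong[OF refl])
      fix c assume c: "c \<in> X"
      have 1: "torus_weight t X z * P c = (\<Prod>l\<in>X - {c}. dens t (z c) (z l)) * torus_weight t (X - {c}) z"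
        unfolding P_def
      proof (rule torus_weight_cross[OF fin(1) c])
        fix b assume "b \<in> X - {c}"
        then show "z c \<noteq> z b \<and> z c \<noteq> t * z b"
          using inj c aX gt[of "z c" "z b"] zX by (auto simp: inj_on_def)
      qed (use zX in auto)
      have 2: "?w c ^ k = ?w c * ?w c ^ (k - 1)" using k by (cases k) auto
      have "(s * (w * p) * (w' * d)) * (q * (x * y)) = s * ((w * w') * e * d * (q * (x' * y)))"
        if "x * p = e * x'" for s w p w' d q x y e x' :: complex
        using that by algebra
      from this[OF 1] show "(1 - t) * (?w c * P c) * h (?w c) * R = (1 - t) * pair_term k ls a c z"
        unfolding pair_term_def h_def R_def 2 .
    qed
    finally show "(LINT u|circle_measure. lead_y k ls a (z(a := u))) = (1 - t) * (\<Sum>c\<in>X. pair_term k ls a c z)" .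
  qed (use fin a in auto)
  also have "\<dots> = (1 - t) * (\<Sum>c\<in>X. integral\<^sup>L (torus ?I) (pair_term k ls a c))"
    using tame_integrable[OF tame_pair_term[OF _ a]] by (simp add: Bochner_Integration.integral_sum)
  finally show ?thesis .
qed

text \<open>Now \<open>x\<^sub>c\<close> carries weight factors with all the remaining variables, so \<open>hl_res\<close> describes the integrand,
  and integrating over \<open>x\<^sub>c\<close> means evaluating at 0.\<close>
lemma integral_pair_term:
  assumes a: "a \<in> Y" and c: "c \<in> X" and len: "length ls + 1 = card (X \<union> Y)"
    and sorted: "sorted_wrt (\<ge>) ls" and nonneg: "\<forall>l\<in>set ls. 0 \<le> int k + l"
  shows "integral\<^sup>L (torus (X \<union> Y - {a})) (pair_term k ls a c) =
    (if int k + last ls = 0 then qnum t (count_list ls (last ls)) * hl_int t r (X - {c}) (Y - {a}) (butlast ls) else 0)"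
proof -
  let ?I = "X \<union> Y - {a}" and ?B = "(X - {c}) \<union> (Y - {a})"
  have aX: "a \<notin> X" and cY: "c \<notin> Y" and ac: "a \<noteq> c" using a c disj by auto
  have I: "?I = insert c ?B" "?I - {c} = ?B" "c \<notin> ?B" using aX cY c by auto
  have card: "length ls = Suc (card ?B)"
  proof -
    have "card (X \<union> Y) = Suc (card ?I)" using a fin by (metis UnI2 card_Suc_Diff1 finite_UnI)
    also have "card ?I = Suc (card ?B)" unfolding I(1) using I(3) fin by simp
    finally show ?thesis using len by simp
  qed
  then have ne: "ls \<noteq> []" by auto
  have sc_c: "sc z c = of_real r * z c" for z using c by (simp add: scaled_def)
  let ?W = "\<lambda>z. torus_weight t (X - {c}) z * torus_weight t (Y - {a}) z"
  define H where "H z = hl_res t (int k) ls ?B (sc z) (of_real r * z c) * ?W z" for z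
  have Hmeas: "H \<in> borel_measurable (torus ?I)"
    unfolding H_def using c aX
    by (intro borel_measurable_times hl_res_measurable scaled_measurable component_measurable torus_weight_measurable) auto
  have H: "pair_term k ls a c z = H z" if inj: "inj_on z ?I" and z: "\<And>i. i \<in> ?I \<Longrightarrow> norm (z i) = 1" for z
  proof -
    have nrm: "norm (sc z i) = (if i \<in> X then r else 1)" if "i \<in> ?I" for i
      using z[OF that] r by (intro norm_scaled) auto
    have "sc z c powi int k * (\<Prod>b\<in>?B. dens t (sc z c) (sc z b)) * hl_sum t ls (insert c ?B) (sc z) =
      hl_res t (int k) ls ?B (sc z) (sc z c)"
    proof (rule hl_res_eq[OF _ I(3) card])
      show "inj_on (sc z) (insert c ?B)"
        unfolding I(1)[symmetric] using inj z r by (intro scaled_inj) auto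
      show "sc z i \<noteq> 0" if "i \<in> insert c ?B" for i
        using nrm[of i] that r unfolding I(1)[symmetric] by (auto split: if_splits)
      show "sc z b \<noteq> t * sc z c" if "b \<in> ?B" for b
      proof
        assume eq: "sc z b = t * sc z c"
        have "norm (sc z c) = r" using nrm[of c] c aX by auto
        moreover have "r \<le> norm (sc z b)" using nrm[of b] that I(1) r by auto
        ultimately have "r \<le> norm t * r" unfolding eq norm_mult by simp
        then show False using t r by simp
      qed
    qed (use fin nonneg in auto)
    moreover have "(\<Prod>b\<in>?B. dens t (sc z c) (sc z b)) =
      (\<Prod>l\<in>X - {c}. dens t (z c) (z l)) * (\<Prod>b\<in>Y - {a}. dens t (of_real r * z c) (z b))"
    proof -
      have "(\<Prod>b\<in>?B. dens t (sc z c) (sc z b)) =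
        (\<Prod>b\<in>X - {c}. dens t (sc z c) (sc z b)) * (\<Prod>b\<in>Y - {a}. dens t (sc z c) (sc z b))"
        using fin disj by (intro prod.union_disjoint) auto
      also have "(\<Prod>b\<in>X - {c}. dens t (sc z c) (sc z b)) = (\<Prod>l\<in>X - {c}. dens t (z c) (z l))"
        using r c by (intro prod.cong) (auto simp: scaled_def dens_scale)
      also have "(\<Prod>b\<in>Y - {a}. dens t (sc z c) (sc z b)) = (\<Prod>b\<in>Y - {a}. dens t (of_real r * z c) (z b))"
        using disj c by (intro prod.cong) (auto simp: scaled_def)
      finally show ?thesis .
    qed
    ultimately show ?thesis
      unfolding pair_term_def H_def I(1)[symmetric] by (simp add: sc_c mult_ac)
  qed
  have t1: "t \<noteq> 1" using t by auto
  define Q where "Q = (if int k + last ls = 0 then qnum t (count_list ls (last ls)) else 0)"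
  have "integral\<^sup>L (torus ?I) (pair_term k ls a c) = integral\<^sup>L (torus ?I) H"
    using H fin by (intro tame_cong(2)[OF tame_pair_term[OF c a] _ Hmeas]) auto
  also have "\<dots> = integral\<^sup>L (torus (?I - {c})) (\<lambda>z. Q * (hl_sum t (butlast ls) ?B (scaled r (X - {c}) z) * ?W z))"
  proof (rule torus_integral_insert)
    show "tame ?I H" using H fin by (intro tame_cong(1)[OF tame_pair_term[OF c a] _ Hmeas]) auto
    show "(\<lambda>z. Q * (hl_sum t (butlast ls) ?B (scaled r (X - {c}) z) * ?W z)) \<in> borel_measurable (torus (?I - {c}))"
      unfolding I(2)
      by (intro borel_measurable_times borel_measurable_const hl_sum_measurable scaled_measurable torus_weight_measurable) auto
    fix z :: "nat \<Rightarrow> complex" assume z: "\<And>j. j \<in> ?I - {c} \<Longrightarrow> norm (z j) = 1"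
    have eq: "H (z(c := u)) = hl_res t (int k) ls ?B (sc z) (of_real r * u) * ?W z" for u
    proof -
      have "hl_res t (int k) ls ?B (sc (z(c := u))) v = hl_res t (int k) ls ?B (sc z) v" for v
        using I(3) by (intro hl_res_cong) (auto simp: scaled_def)
      moreover have "torus_weight t (X - {c}) (z(c := u)) = torus_weight t (X - {c}) z"
        "torus_weight t (Y - {a}) (z(c := u)) = torus_weight t (Y - {a}) z"
        using cY by - (rule torus_weight_cong, auto split: if_splits)+
      ultimately show ?thesis unfolding H_def by simp
    qed
    have holo: "(\<lambda>u. hl_res t (int k) ls ?B (sc z) (of_real r * u)) holomorphic_on cball 0 1"
    proof (rule hl_res_holomorphic[OF t])
      fix b assume "b \<in> ?B"
      then have "norm (z b) = 1" using z I(2) by blast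
      then show "r \<le> norm (sc z b)" using r by (simp add: norm_scaled)
    qed (use r in auto)
    have meas: "(\<lambda>u. hl_res t (int k) ls ?B (sc z) (of_real r * u)) \<in> borel_measurable borel"
      by (intro hl_res_measurable) auto
    have "(LINT u|circle_measure. H (z(c := u))) = hl_res t (int k) ls ?B (sc z) 0 * ?W z"
      unfolding eq using circle_mean_value(2)[OF holo meas] by simp
    also have "hl_res t (int k) ls ?B (sc z) 0 = Q * hl_sum t (butlast ls) ?B (sc z)"
      using hl_res_0[OF _ card sorted, of "int k" t "sc z"] fin nonneg ne t1 last_in_set[OF ne] unfolding Q_def by auto
    also have "hl_sum t (butlast ls) ?B (sc z) = hl_sum t (butlast ls) ?B (scaled r (X - {c}) z)"
      using cY by (intro hl_sum_cong) (auto simp: scaled_def)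
    finally show "(LINT u|circle_measure. H (z(c := u))) = Q * (hl_sum t (butlast ls) ?B (scaled r (X - {c}) z) * ?W z)"
      by (simp only: mult.assoc)
  qed (use fin c aX in auto)
  also have "\<dots> = Q * hl_int t r (X - {c}) (Y - {a}) (butlast ls)"
    unfolding I(2) hl_int_def by simp
  finally show ?thesis unfolding Q_def by simp
qed

lemma hl_int_recursion:
  assumes "0 < k" "length ls + 1 = card (X \<union> Y)" "sorted_wrt (\<ge>) ls" "\<forall>l\<in>set ls. 0 \<le> int k + l"
  shows "hl_int t r X Y (int k # ls) = (if int k + last ls = 0 then
      (1 - t) * qnum t (count_list ls (last ls)) * (\<Sum>a\<in>Y. \<Sum>c\<in>X. hl_int t r (X - {c}) (Y - {a}) (butlast ls)) else 0)"
  unfolding hl_int_Cons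
  using assms by (simp add: integral_lead_x integral_lead_y integral_pair_term sum_distrib_left mult_ac)

end

section \<open>Removing the regularization\<close>

lemma hl_sum_tendsto:
  assumes "\<And>i. i \<in> A \<Longrightarrow> ((\<lambda>n. w n i) \<longlongrightarrow> v i) F" "inj_on v A" "\<And>i. i \<in> A \<Longrightarrow> v i \<noteq> 0"
  shows "((\<lambda>n. hl_sum t ls A (w n)) \<longlongrightarrow> hl_sum t ls A v) F"
  using assms
proof (induction ls arbitrary: A)
  case (Cons l ls)
  have "((\<lambda>n. hl_sum t ls (A - {a}) (w n)) \<longlongrightarrow> hl_sum t ls (A - {a}) v) F" for a
    using Cons.prems by (intro Cons.IH) (auto intro: inj_on_subset)
  then show ?case
    unfolding hl_sum.simps cross_def using Cons.prems
    by (intro tendsto_sum tendsto_mult tendsto_prod tendsto_divide tendsto_diff tendsto_power_int tendsto_const)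
      (auto simp: inj_on_def)
qed simp

lemma scaled_1 [simp]: "scaled 1 X z = z"
  by (auto simp: scaled_def)

lemma hl_int_1: "hl_int t 1 X Y ls =
  (LINT z|torus (X \<union> Y). hl_sum t ls (X \<union> Y) z * (torus_weight t X z * torus_weight t Y z))"
  by (simp add: hl_int_def)

text \<open>The symmetrized sum is bounded uniformly in \<open>r\<close> and continuous at points with distinct coordinates,
  so dominated convergence applies.\<close>
lemma hl_int_tendsto:
  assumes t: "norm t < 1" and fin: "finite X" "finite Y"
  shows "(\<lambda>n. hl_int t (1 - 1 / (real n + 2)) X Y ls) \<longlonglongrightarrow> hl_int t 1 X Y ls"
proof -
  let ?I = "X \<union> Y"
  define r where "r n = 1 - 1 / (real n + 2)" for n
  have r: "1/2 \<le> r n" "r n \<le> 1" for n by (auto simp: r_def field_simps)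
  have r_lim: "r \<longlonglongrightarrow> 1" unfolding r_def by real_asymp
  obtain C where C: "\<And>r z. 1/2 \<le> r \<Longrightarrow> r \<le> 1 \<Longrightarrow> inj_on z ?I \<Longrightarrow> \<forall>i\<in>?I. norm (z i) = 1 \<Longrightarrow>
      norm (hl_sum t ls ?I (scaled r X z)) \<le> C"
    using hl_sum_scaled_bounded[of ?I t ls X] fin by blast
  let ?W = "\<lambda>z. torus_weight t X z * torus_weight t Y z"
  have W: "tame ?I ?W" using t fin by (intro tame_mult tame_torus_weight) auto
  obtain D where D: "AE z in torus ?I. norm (?W z) \<le> D" using W by (auto simp: tame_def)
  have good: "AE z in torus ?I. inj_on z ?I \<and> (\<forall>i\<in>?I. norm (z i) = 1)"
    using fin by (intro AE_torus) auto
  have tame: "tame ?I (\<lambda>z. hl_sum t ls ?I (scaled s X z) * ?W z)" if "1/2 \<le> s" "s \<le> 1" for s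
    using that fin by (intro tame_mult tame_hl_sum tame_torus_weight t) auto
  have "(\<lambda>n. LINT z|torus ?I. hl_sum t ls ?I (scaled (r n) X z) * ?W z) \<longlonglongrightarrow>
      (LINT z|torus ?I. hl_sum t ls ?I (scaled 1 X z) * ?W z)"
  proof (rule integral_dominated_convergence)
    show "integrable (torus ?I) (\<lambda>_. C * D)"
      by (intro finite_measure.integrable_const prob_space.finite_measure prob_space_torus)
    show "AE z in torus ?I. (\<lambda>n. hl_sum t ls ?I (scaled (r n) X z) * ?W z) \<longlonglongrightarrow> hl_sum t ls ?I (scaled 1 X z) * ?W z"
      using good
    proof eventually_elim
      case (elim z)
      have "(\<lambda>n. hl_sum t ls ?I (scaled (r n) X z)) \<longlonglongrightarrow> hl_sum t ls ?I z"
      proof (rule hl_sum_tendsto)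
        fix i assume "i \<in> ?I"
        have "(\<lambda>n. of_real (r n) * z i) \<longlonglongrightarrow> of_real 1 * z i"
          by (intro tendsto_intros r_lim)
        then show "(\<lambda>n. scaled (r n) X z i) \<longlonglongrightarrow> z i"
          unfolding scaled_def by (cases "i \<in> X") simp_all
        show "z i \<noteq> 0" if "i \<in> ?I" for i using elim that by force
      qed (use elim in auto)
      then show ?case by (auto intro!: tendsto_intros)
    qed
    show "AE z in torus ?I. norm (hl_sum t ls ?I (scaled (r n) X z) * ?W z) \<le> C * D" for n
      using good D
    proof eventually_elim
      case (elim z)
      then have "norm (hl_sum t ls ?I (scaled (r n) X z)) \<le> C" by (intro C r) auto
      then show ?case
        unfolding norm_mult[of "hl_sum t ls ?I (scaled (r n) X z)"] using elim
        by (intro mult_mono) (auto intro: order_trans[OF norm_ge_zero])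
    qed
  qed (use tame[of 1] tame[OF r] in \<open>simp_all add: tame_def\<close>)
  then show ?thesis unfolding hl_int_def r_def by simp
qed

text \<open>Both sides of the regularized recursion converge as \<open>r\<close> tends to 1.\<close>
lemma hl_int_1_recursion:
  assumes t: "norm t < 1" and fin: "finite X" "finite Y" and disj: "X \<inter> Y = {}"
    and ls: "0 < k" "length ls + 1 = card (X \<union> Y)" "sorted_wrt (\<ge>) ls" "\<forall>l\<in>set ls. 0 \<le> int k + l"
  shows "hl_int t 1 X Y (int k # ls) = (if int k + last ls = 0 then
      (1 - t) * qnum t (count_list ls (last ls)) * (\<Sum>a\<in>Y. \<Sum>c\<in>X. hl_int t 1 (X - {c}) (Y - {a}) (butlast ls)) else 0)"
proof -
  let ?R = "\<lambda>r. if int k + last ls = 0 then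
      (1 - t) * qnum t (count_list ls (last ls)) * (\<Sum>a\<in>Y. \<Sum>c\<in>X. hl_int t r (X - {c}) (Y - {a}) (butlast ls)) else 0"
  have "hl_int t (1 - 1 / (real n + 2)) X Y (int k # ls) = ?R (1 - 1 / (real n + 2))" for n
  proof -
    interpret scaled_blocks t "1 - 1 / (real n + 2)" X Y
      using t fin disj by unfold_locales (auto simp: field_simps)
    show ?thesis using ls by (rule hl_int_recursion)
  qed
  moreover have "(\<lambda>n. ?R (1 - 1 / (real n + 2))) \<longlonglongrightarrow> ?R 1"
    using fin t by (auto intro!: tendsto_intros hl_int_tendsto)
  moreover have "(\<lambda>n. hl_int t (1 - 1 / (real n + 2)) X Y (int k # ls)) \<longlonglongrightarrow> hl_int t 1 X Y (int k # ls)"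
    by (intro hl_int_tendsto t fin)
  ultimately show ?thesis by (simp only: LIMSEQ_unique)
qed

section \<open>Complex conjugation\<close>

lemma word_term_snoc:
  "length xs = length ks \<Longrightarrow>
    word_term t (ks @ [k]) (xs @ [x]) = word_term t ks xs * x powi k * (\<Prod>y\<leftarrow>xs. cross t y x)"
proof (induction ks arbitrary: xs)
  case (Cons l ks)
  then obtain y ys where "xs = y # ys" "length ys = length ks" by (cases xs) auto
  then show ?case using Cons.IH[of ys] by (simp add: mult_ac)
qed simp

lemma cross_inverse: "a \<noteq> 0 \<Longrightarrow> b \<noteq> 0 \<Longrightarrow> cross t (inverse a) (inverse b) = cross t b a"
  unfolding cross_def by (cases "a = b") (simp_all add: field_simps)

text \<open>Inverting the variables turns \<open>cross t a b\<close> into \<open>cross t b a\<close>, which is undone by reversing the word.\<close>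
lemma word_term_rev_inverse:
  "length xs = length ks \<Longrightarrow> \<forall>x\<in>set xs. x \<noteq> 0 \<Longrightarrow>
    word_term t (rev (map uminus ks)) (rev (map inverse xs)) = word_term t ks xs"
proof (induction ks arbitrary: xs)
  case (Cons k ks)
  then obtain x ys where xs: "xs = x # ys" "length ys = length ks" by (cases xs) auto
  have "(\<Prod>y\<leftarrow>rev (map inverse ys). cross t y (inverse x)) = (\<Prod>y\<leftarrow>ys. cross t x y)"
  proof -
    have "(\<Prod>y\<leftarrow>rev (map inverse ys). cross t y (inverse x)) =
        prod_list (rev (map (\<lambda>y. cross t (inverse y) (inverse x)) ys))"
      by (simp add: rev_map o_def)
    also have "map (\<lambda>y. cross t (inverse y) (inverse x)) ys = map (cross t x) ys"
      using Cons.prems(2) unfolding xs by (intro map_cong) (auto simp: cross_inverse)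
    finally show ?thesis by (simp add: prod_list.rev)
  qed
  then show ?case
    using Cons.IH[of ys] Cons.prems(2) xs
    by (simp add: word_term_snoc power_int_minus power_int_inverse mult_ac)
qed simp

lemma hl_sum_rev_inverse:
  assumes "finite A" "card A = length ls" "\<And>i. i \<in> A \<Longrightarrow> z i \<noteq> 0"
  shows "hl_sum t (rev (map uminus ls)) A (\<lambda>i. inverse (z i)) = hl_sum t ls A z"
proof -
  let ?P = "permutations_of_set A"
  have "hl_sum t (rev (map uminus ls)) A (\<lambda>i. inverse (z i)) =
      (\<Sum>xs\<in>?P. word_term t (rev (map uminus ls)) (map (\<lambda>i. inverse (z i)) xs))"
    using assms by (intro hl_sum_words) auto
  also have "\<dots> = (\<Sum>xs\<in>?P. word_term t (rev (map uminus ls)) (map (\<lambda>i. inverse (z i)) (rev xs)))"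
    by (rule sum.reindex_bij_witness[of _ rev rev]) (auto simp: permutations_of_set_def)
  also have "\<dots> = (\<Sum>xs\<in>?P. word_term t ls (map z xs))"
  proof (rule sum.cong[OF refl])
    fix xs assume xs: "xs \<in> ?P"
    then have len: "length (map z xs) = length ls"
      using assms(2) length_finite_permutations_of_set[OF xs] by simp
    have "map (\<lambda>i. inverse (z i)) (rev xs) = rev (map inverse (map z xs))" by (simp add: rev_map o_def)
    then show "word_term t (rev (map uminus ls)) (map (\<lambda>i. inverse (z i)) (rev xs)) = word_term t ls (map z xs)"
      using word_term_rev_inverse[OF len] xs assms(3) by (auto simp: permutations_of_set_def)
  qed
  also have "\<dots> = hl_sum t ls A z" using assms by (intro hl_sum_words[symmetric]) auto
  finally show ?thesis .
qed

lemma cnj_powi: "cnj (z powi k) = cnj z powi k"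
  by (simp add: power_int_def)

lemma cnj_hl_sum: "cnj (hl_sum t ls A z) = hl_sum (cnj t) ls A (\<lambda>i. cnj (z i))"
  by (induction ls arbitrary: A) (simp_all add: cross_def cnj_powi)

lemma torus_weight_inverse:
  assumes "finite I"
  shows "torus_weight t I (\<lambda>i. inverse (z i)) = torus_weight t I z"
proof -
  let ?f = "\<lambda>i j. (1 - z i * inverse (z j)) / (1 - t * z i * inverse (z j))"
  have set: "I - {i} = {j \<in> I. i \<noteq> j}" for i by auto
  have "torus_weight t I (\<lambda>i. inverse (z i)) = (\<Prod>i\<in>I. \<Prod>j\<in>{j \<in> I. i \<noteq> j}. ?f j i)"
    unfolding torus_weight_def set by (simp add: mult_ac)
  also have "\<dots> = (\<Prod>j\<in>I. \<Prod>i\<in>{i \<in> I. i \<noteq> j}. ?f j i)"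
    using assms by (intro prod.swap_restrict) auto
  also have "\<dots> = torus_weight t I z"
  proof -
    have "{i \<in> I. i \<noteq> j} = I - {j}" for j by auto
    then show ?thesis unfolding torus_weight_def by simp
  qed
  finally show ?thesis .
qed

lemma cnj_torus_weight: "cnj (torus_weight t I z) = torus_weight (cnj t) I (\<lambda>i. cnj (z i))"
  by (simp add: torus_weight_def)

text \<open>On the unit circle conjugation is inversion, and inverting all variables negates and reverses the
  exponents. This exchanges the roles of the first and the last exponent.\<close>
lemma hl_int_cnj:
  assumes t: "norm t < 1" and fin: "finite X" "finite Y" and len: "length ls = card (X \<union> Y)"
  shows "cnj (hl_int t 1 X Y ls) = hl_int (cnj t) 1 X Y (rev (map uminus ls))"
proof -
  let ?I = "X \<union> Y"
  let ?g = "\<lambda>z. hl_sum (cnj t) (rev (map uminus ls)) ?I z * (torus_weight (cnj t) X z * torus_weight (cnj t) Y z)"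
  have g: "tame ?I ?g"
    using tame_mult[OF tame_hl_sum[where r=1 and X = X and I = ?I] tame_mult[OF tame_torus_weight tame_torus_weight],
        of ?I "cnj t" X "cnj t" Y "cnj t" "rev (map uminus ls)"] t fin by simp
  have f: "tame ?I (\<lambda>z. hl_sum t ls ?I z * (torus_weight t X z * torus_weight t Y z))"
    using tame_mult[OF tame_hl_sum[where r=1 and X = X and I = ?I] tame_mult[OF tame_torus_weight tame_torus_weight],
        of ?I "t" X "t" Y "t" "ls"] t fin by simp
  have "cnj (hl_int t 1 X Y ls) =
      (LINT z|torus ?I. cnj (hl_sum t ls ?I z * (torus_weight t X z * torus_weight t Y z)))"
    unfolding hl_int_1 by (rule Bochner_Integration.integral_cnj[symmetric])
  also have "\<dots> = (LINT z|torus ?I. ?g z)"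
  proof (rule sym, rule tame_cong(2)[OF g])
    show "(\<lambda>z. cnj (hl_sum t ls ?I z * (torus_weight t X z * torus_weight t Y z))) \<in> borel_measurable (torus ?I)"
      using measurable_compose[OF conjunct1[OF f[unfolded tame_def]], of cnj borel]
      by (simp add: borel_measurable_continuous_onI continuous_on_cnj)
    fix z :: "nat \<Rightarrow> complex" assume z: "\<And>i. i \<in> ?I \<Longrightarrow> norm (z i) = 1"
    have inv: "cnj (z i) = inverse (z i)" if "i \<in> ?I" for i
      using z[OF that] complex_norm_square[of "z i"] by (intro inverse_unique[symmetric]) simp
    have "cnj (hl_sum t ls ?I z) = hl_sum (cnj t) ls ?I (\<lambda>i. inverse (z i))"
      unfolding cnj_hl_sum by (intro hl_sum_cong inv)
    also have "\<dots> = hl_sum (cnj t) (rev (map uminus ls)) ?I (\<lambda>i. inverse (inverse (z i)))"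
      using fin len z by (intro hl_sum_rev_inverse[symmetric]) force+
    finally have "cnj (hl_sum t ls ?I z) = hl_sum (cnj t) (rev (map uminus ls)) ?I z" by simp
    moreover have "cnj (torus_weight t J z) = torus_weight (cnj t) J z" if "J \<subseteq> ?I" for J
    proof -
      have "cnj (torus_weight t J z) = torus_weight (cnj t) J (\<lambda>i. inverse (z i))"
        unfolding cnj_torus_weight using that by (intro torus_weight_cong inv) auto
      also have "\<dots> = torus_weight (cnj t) J z"
        using that fin by (intro torus_weight_inverse) (auto intro: finite_subset)
      finally show ?thesis .
    qed
    ultimately show "?g z = cnj (hl_sum t ls ?I z * (torus_weight t X z * torus_weight t Y z))" by simp
  qed (use fin in auto)
  finally show ?thesis unfolding hl_int_1 .
qed

section \<open>The normalization\<close>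

text \<open>The total mass of the weight, which is the normalization up to factorials.\<close>
definition weight_int :: "complex \<Rightarrow> nat set \<Rightarrow> nat set \<Rightarrow> complex" where
  "weight_int t X Y = (LINT z|torus (X \<union> Y). torus_weight t X z * torus_weight t Y z)"

lemma qnum_nonzero: "norm t < 1 \<Longrightarrow> 0 < n \<Longrightarrow> qnum t n \<noteq> 0"
proof -
  assume t: "norm t < 1" and n: "0 < n"
  then have "norm (t ^ n) < 1" unfolding norm_power by (intro power_less_one_iff[THEN iffD2]) auto
  then have "t ^ n \<noteq> 1" by auto
  moreover have "t \<noteq> 1" using t by auto
  ultimately show ?thesis by (simp add: qnum_def)
qed

lemma qfact_nonzero: "norm t < 1 \<Longrightarrow> qfact t n \<noteq> 0"
  unfolding qfact_def using qnum_nonzero by (auto simp: prod_zero_iff)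

lemma weight_int_commute: "weight_int t X Y = weight_int t Y X"
  unfolding weight_int_def by (simp add: Un_commute mult.commute)

text \<open>The identity \<open>sum_cross_eq_qnum\<close> is inserted under the integral; for each \<open>a\<close> the weight then becomes
  holomorphic in \<open>z a\<close>, and the mean value property replaces \<open>z a\<close> by 0.\<close>
lemma weight_int_remove:
  assumes t: "norm t < 1" and fin: "finite X" "finite Y" and disj: "X \<inter> Y = {}"
  shows "qnum t (card X) * weight_int t X Y = (\<Sum>a\<in>X. weight_int t (X - {a}) Y)"
proof -
  let ?I = "X \<union> Y"
  let ?f = "\<lambda>a z. (\<Prod>b\<in>X - {a}. dens t (z a) (z b)) * (torus_weight t (X - {a}) z * torus_weight t Y z)"
  have t1: "t \<noteq> 1" using t by auto
  have tame: "tame ?I (?f a)" if a: "a \<in> X" for a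
  proof (rule tame_mult)
    show "tame ?I (\<lambda>z. \<Prod>b\<in>X - {a}. dens t (z a) (z b))"
    proof (rule tame_boundI)
      show "(\<lambda>z. \<Prod>b\<in>X - {a}. dens t (z a) (z b)) \<in> borel_measurable (torus ?I)"
        using a by (intro borel_measurable_prod dens_measurable component_measurable) auto
      fix z :: "nat \<Rightarrow> complex" assume z: "\<And>i. i \<in> ?I \<Longrightarrow> norm (z i) = 1"
      show "norm (\<Prod>b\<in>X - {a}. dens t (z a) (z b)) \<le> (\<Prod>b\<in>X - {a}. 2 / (1 - norm t))"
        using t z a by (intro norm_prod_le_const norm_dens_le) auto
    qed (use fin in auto)
    show "tame ?I (\<lambda>z. torus_weight t (X - {a}) z * torus_weight t Y z)"
      using t fin by (intro tame_mult tame_torus_weight) auto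
  qed
  have "qnum t (card X) * weight_int t X Y =
      (LINT z|torus ?I. qnum t (card X) * (torus_weight t X z * torus_weight t Y z))"
    unfolding weight_int_def by simp
  also have "\<dots> = (LINT z|torus ?I. (\<Sum>a\<in>X. ?f a z))"
  proof (rule tame_cong(2))
    show "tame ?I (\<lambda>z. qnum t (card X) * (torus_weight t X z * torus_weight t Y z))"
      using t fin by (intro tame_mult[of _ "\<lambda>z. qnum t (card X)"] tame_mult tame_torus_weight tame_boundI[of _ "\<lambda>z. qnum t (card X)"]) auto
    show "(\<lambda>z. \<Sum>a\<in>X. ?f a z) \<in> borel_measurable (torus ?I)"
      using tame by (intro borel_measurable_sum) (auto simp: tame_def)
    fix z :: "nat \<Rightarrow> complex" assume inj: "inj_on z ?I" and z: "\<And>i. i \<in> ?I \<Longrightarrow> norm (z i) = 1"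
    have nz: "z i \<noteq> 0" if "i \<in> X" for i using z[of i] that by auto
    have q: "qnum t (card X) = (\<Sum>a\<in>X. \<Prod>b\<in>X - {a}. cross t (z a) (z b))"
      using fin inj nz t1 by (intro sum_cross_eq_qnum[symmetric]) (auto intro: inj_on_subset)
    show "qnum t (card X) * (torus_weight t X z * torus_weight t Y z) = (\<Sum>a\<in>X. ?f a z)"
      unfolding q sum_distrib_right
    proof (rule sum.cong[OF refl])
      fix a assume a: "a \<in> X"
      have "torus_weight t X z * (\<Prod>b\<in>X - {a}. cross t (z a) (z b)) =
        (\<Prod>b\<in>X - {a}. dens t (z a) (z b)) * torus_weight t (X - {a}) z"
      proof (rule torus_weight_cross[OF fin(1) a])
        fix b assume b: "b \<in> X - {a}"
        have "z a \<noteq> t * z b"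
        proof
          assume "z a = t * z b"
          then have "norm (z a) = norm t * norm (z b)" by (simp add: norm_mult)
          then show False using z[of a] z[of b] a b t by simp
        qed
        then show "z a \<noteq> z b \<and> z a \<noteq> t * z b" using inj a b by (auto simp: inj_on_def)
      qed (use nz in auto)
      then show "(\<Prod>b\<in>X - {a}. cross t (z a) (z b)) * (torus_weight t X z * torus_weight t Y z) = ?f a z"
        by algebra
    qed
  qed (use fin in auto)
  also have "\<dots> = (\<Sum>a\<in>X. integral\<^sup>L (torus ?I) (?f a))"
    using tame_integrable[OF tame] by (simp add: Bochner_Integration.integral_sum)
  also have "\<dots> = (\<Sum>a\<in>X. weight_int t (X - {a}) Y)"
  proof (rule sum.cong[OF refl])
    fix a assume a: "a \<in> X"
    have aY: "a \<notin> Y" using a disj by auto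
    have I: "?I - {a} = (X - {a}) \<union> Y" using aY by auto
    show "integral\<^sup>L (torus ?I) (?f a) = weight_int t (X - {a}) Y"
      unfolding weight_int_def I[symmetric]
    proof (rule torus_integral_insert[OF tame[OF a]])
      show "(\<lambda>z. torus_weight t (X - {a}) z * torus_weight t Y z) \<in> borel_measurable (torus (?I - {a}))"
        unfolding I by (intro borel_measurable_times torus_weight_measurable) auto
      fix z :: "nat \<Rightarrow> complex" assume z: "\<And>j. j \<in> ?I - {a} \<Longrightarrow> norm (z j) = 1"
      define h where "h u = (\<Prod>b\<in>X - {a}. dens t u (z b))" for u
      have "torus_weight t (X - {a}) (z(a := u)) = torus_weight t (X - {a}) z"
        "torus_weight t Y (z(a := u)) = torus_weight t Y z" for u
        using aY by - (rule torus_weight_cong, auto split: if_splits)+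
      moreover have "(\<Prod>b\<in>X - {a}. dens t u ((z(a := u)) b)) = h u" for u
        unfolding h_def by (intro prod.cong) auto
      ultimately have eq: "?f a (z(a := u)) = h u * (torus_weight t (X - {a}) z * torus_weight t Y z)" for u
        by simp
      have "h holomorphic_on cball 0 1"
        unfolding h_def using z aY t dens_holomorphic[of t 1] by (intro holomorphic_intros) auto
      moreover have "h \<in> borel_measurable borel"
        unfolding h_def by (intro borel_measurable_prod dens_measurable borel_measurable_const) auto
      ultimately have "(LINT u|circle_measure. h u) = h 0" by (rule circle_mean_value)
      then show "(LINT u|circle_measure. ?f a (z(a := u))) = torus_weight t (X - {a}) z * torus_weight t Y z"
        unfolding eq by (simp add: h_def dens_def)
    qed (use fin a in auto)
  qed
  finally show ?thesis .
qed

lemma weight_int_block: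
  assumes t: "norm t < 1" and fin: "finite X" "finite Y" and disj: "X \<inter> Y = {}"
  shows "qfact t (card X) * weight_int t X Y = fact (card X) * weight_int t {} Y"
  using fin(1) disj
proof (induction "card X" arbitrary: X)
  case 0
  then show ?case by (simp add: qfact_def)
next
  case (Suc n)
  have IH: "qfact t n * weight_int t (X - {a}) Y = fact n * weight_int t {} Y" if "a \<in> X" for a
  proof -
    have "n = card (X - {a})" using Suc.hyps(2) Suc.prems that by simp
    then show ?thesis using Suc.hyps(1)[of "X - {a}"] Suc.prems by auto
  qed
  have "qfact t (Suc n) * weight_int t X Y = qfact t n * (qnum t (card X) * weight_int t X Y)"
    by (simp add: qfact_Suc Suc.hyps(2)[symmetric])
  also have "\<dots> = (\<Sum>a\<in>X. qfact t n * weight_int t (X - {a}) Y)"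
    using weight_int_remove[OF t Suc.prems(1) fin(2) Suc.prems(2)] by (simp add: sum_distrib_left)
  also have "\<dots> = fact (Suc n) * weight_int t {} Y"
    using IH Suc.hyps(2)[symmetric] by (simp add: fact_Suc)
  finally show ?case using Suc.hyps(2) by simp
qed

lemma weight_int_value:
  assumes t: "norm t < 1" and fin: "finite X" "finite Y" and disj: "X \<inter> Y = {}"
  shows "weight_int t X Y = fact (card X) * fact (card Y) / (qfact t (card X) * qfact t (card Y))"
proof -
  have "weight_int t {} {} = 1"
    using prob_space.prob_space[OF prob_space_torus[of "{}"]] by (simp add: weight_int_def torus_weight_def)
  moreover have "qfact t (card Y) * weight_int t {} Y = fact (card Y) * weight_int t {} {}"
    using weight_int_block[OF t fin(2), of "{}"] by (simp add: weight_int_commute[of t "{}" Y])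
  ultimately have "weight_int t {} Y = fact (card Y) / qfact t (card Y)"
    using qfact_nonzero[OF t, of "card Y"] by (simp add: field_simps)
  then have "qfact t (card X) * weight_int t X Y = fact (card X) * (fact (card Y) / qfact t (card Y))"
    using weight_int_block[OF assms] by simp
  moreover have "weight_int t X Y = qfact t (card X) * weight_int t X Y / qfact t (card X)"
    using qfact_nonzero[OF t, of "card X"] by simp
  ultimately show ?thesis by (simp add: mult.commute)
qed

lemma hl_int_zero_weight:
  assumes t: "norm t < 1" and fin: "finite X" "finite Y" and disj: "X \<inter> Y = {}" and N: "N = card (X \<union> Y)"
  shows "hl_int t 1 X Y (replicate N 0) = qfact t N * weight_int t X Y"
proof -
  let ?I = "X \<union> Y"
  have t1: "t \<noteq> 1" using t by auto
  have f: "tame ?I (\<lambda>z. hl_sum t (replicate N 0) ?I z * (torus_weight t X z * torus_weight t Y z))"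
    using tame_mult[OF tame_hl_sum[where r=1 and X = X and I = ?I] tame_mult[OF tame_torus_weight tame_torus_weight],
        of ?I "t" X "t" Y "t" "replicate N 0"] t fin by simp
  have "hl_int t 1 X Y (replicate N 0) =
      (LINT z|torus ?I. qfact t N * (torus_weight t X z * torus_weight t Y z))"
    unfolding hl_int_1
  proof (rule tame_cong(2)[OF f])
    show "(\<lambda>z. qfact t N * (torus_weight t X z * torus_weight t Y z)) \<in> borel_measurable (torus ?I)"
      by (intro borel_measurable_times borel_measurable_const torus_weight_measurable) auto
    fix z :: "nat \<Rightarrow> complex" assume inj: "inj_on z ?I" and z: "\<And>i. i \<in> ?I \<Longrightarrow> norm (z i) = 1"
    have "z i \<noteq> 0" if "i \<in> ?I" for i using z[OF that] by auto
    then show "hl_sum t (replicate N 0) ?I z * (torus_weight t X z * torus_weight t Y z) =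
        qfact t N * (torus_weight t X z * torus_weight t Y z)"
      unfolding N using fin inj t1 by (subst hl_sum_zero) auto
  qed (use fin in auto)
  then show ?thesis by (simp add: weight_int_def)
qed

section \<open>Evaluation\<close>

text \<open>For a partition this is \<^const>\<open>Cminus\<close> without its power of \<open>1 - t\<close>, and also the contribution of the
  positive exponents, or of the negative ones, to \<^const>\<open>HL_v\<close>.\<close>
definition mult_fact :: "complex \<Rightarrow> nat list \<Rightarrow> complex" where
  "mult_fact t \<mu> = (\<Prod>i\<in>set \<mu>. qfact t (count_list \<mu> i))"

lemma mult_fact_Cons: "mult_fact t (k # \<mu>) = qnum t (Suc (count_list \<mu> k)) * mult_fact t \<mu>"
proof -
  have "(\<Prod>i\<in>set \<mu> - {k}. qfact t (count_list (k # \<mu>) i)) = (\<Prod>i\<in>set \<mu> - {k}. qfact t (count_list \<mu> i))"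
    by (intro prod.cong) auto
  moreover have "mult_fact t (k # \<mu>) = qfact t (Suc (count_list \<mu> k)) * (\<Prod>i\<in>set \<mu> - {k}. qfact t (count_list (k # \<mu>) i))"
    unfolding mult_fact_def using prod.insert_remove[of "set \<mu>" "\<lambda>i. qfact t (count_list (k # \<mu>) i)" k] by simp
  moreover have "mult_fact t \<mu> = qfact t (count_list \<mu> k) * (\<Prod>i\<in>set \<mu> - {k}. qfact t (count_list \<mu> i))"
  proof (cases "k \<in> set \<mu>")
    case True
    then show ?thesis unfolding mult_fact_def by (intro prod.remove) auto
  next
    case False
    then show ?thesis by (simp add: mult_fact_def count_list_0_iff qfact_def)
  qed
  ultimately show ?thesis by (simp add: qfact_Suc)
qed

lemma mult_fact_nonzero: "norm t < 1 \<Longrightarrow> mult_fact t \<mu> \<noteq> 0"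
  unfolding mult_fact_def by (simp add: qfact_nonzero)

lemma is_partition_Cons: "is_partition (k # \<mu>) \<longleftrightarrow> 0 < k \<and> (\<forall>l\<in>set \<mu>. l \<le> k) \<and> is_partition \<mu>"
  by (auto simp: is_partition_def)

lemma bar_weight_sorted:
  assumes "is_partition \<mu>" "is_partition \<nu>"
  shows "sorted_wrt (\<ge>) (bar_weight N \<mu> \<nu>)"
proof -
  have rep: "sorted_wrt (\<ge>) (replicate n x)" for n and x :: int by (induction n) auto
  have "sorted_wrt (\<ge>) (map int \<mu>)"
    using assms(1) by (simp add: is_partition_def sorted_wrt_map)
  moreover have "sorted_wrt (\<ge>) (rev (map (\<lambda>k. - int k) \<nu>))"
    using assms(2) by (simp add: is_partition_def sorted_wrt_rev sorted_wrt_map)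
  ultimately show ?thesis
    unfolding bar_weight_def by (auto simp: sorted_wrt_append rep)
qed

lemma bar_weight_rev: "rev (map uminus (bar_weight N \<mu> \<nu>)) = bar_weight N \<nu> \<mu>"
  by (simp add: bar_weight_def rev_map o_def add.commute)

lemma length_bar_weight: "length \<mu> + length \<nu> \<le> N \<Longrightarrow> length (bar_weight N \<mu> \<nu>) = N"
  by (simp add: bar_weight_def)

lemma bar_weight_ends:
  assumes "length \<mu> + length \<nu> + 2 \<le> N"
  shows "bar_weight N (k # \<mu>) (l # \<nu>) = int k # bar_weight (N - 2) \<mu> \<nu> @ [- int l]"
  using assms by (simp add: bar_weight_def numeral_2_eq_2)

lemma count_bar_weight_neg:
  assumes "0 < l" shows "count_list (bar_weight N \<mu> \<nu>) (- int l) = count_list \<nu> l"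
proof -
  have "count_list (map int \<mu>) (- int l) = 0" "count_list (replicate n 0) (- int l) = 0" for n
    using assms by (auto simp: count_list_0_iff)
  moreover have "count_list (map (\<lambda>k. - int k) \<nu>) (- int l) = count_list \<nu> l"
    by (induction \<nu>) auto
  ultimately show ?thesis by (simp add: bar_weight_def)
qed

text \<open>Every exponent is larger than \<open>-k\<close>, so the recursion gives zero.\<close>
lemma hl_int_larger_first:
  assumes t: "norm t < 1" and fin: "finite X" "finite Y" and disj: "X \<inter> Y = {}"
    and N: "N = card (X \<union> Y)" "length \<nu> + length (k # \<mu>) \<le> N"
    and part: "is_partition (k # \<mu>)" "is_partition \<nu>" and less: "\<forall>l\<in>set \<nu>. l < k"
  shows "hl_int t 1 X Y (bar_weight N (k # \<mu>) \<nu>) = 0"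
proof -
  obtain ls where ls: "bar_weight N (k # \<mu>) \<nu> = int k # ls" by (simp add: bar_weight_def)
  have len: "length ls + 1 = card (X \<union> Y)"
    using length_bar_weight[of "k # \<mu>" \<nu> N] N unfolding ls by simp
  have pos: "\<forall>l\<in>set ls. 0 < int k + l"
  proof
    fix l assume "l \<in> set ls"
    then have "l \<in> set (bar_weight N (k # \<mu>) \<nu>)" unfolding ls by simp
    then show "0 < int k + l"
      using part(1) less by (auto simp: bar_weight_def is_partition_Cons split: if_splits)
  qed
  have sorted: "sorted_wrt (\<ge>) ls"
    using bar_weight_sorted[OF part, of N] unfolding ls by simp
  have "0 < k" using part(1) by (simp add: is_partition_Cons)
  note rec = hl_int_1_recursion[OF t fin disj this len sorted]
  show ?thesis
  proof (cases "ls = []")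
    case True
    then have "card X + card Y = 1" using len fin disj by (simp add: card_Un_disjoint)
    then have "X = {} \<or> Y = {}" using fin by (cases "card X") auto
    then show ?thesis unfolding ls using rec True by auto
  next
    case False
    then have "0 < int k + last ls" using pos by simp
    moreover have "\<forall>l\<in>set ls. 0 \<le> int k + l" using pos by auto
    ultimately show ?thesis unfolding ls using rec by auto
  qed
qed

text \<open>The mirror image under conjugation.\<close>
lemma hl_int_larger_last:
  assumes t: "norm t < 1" and fin: "finite X" "finite Y" and disj: "X \<inter> Y = {}"
    and N: "N = card (X \<union> Y)" "length \<mu> + length (k # \<nu>) \<le> N"
    and part: "is_partition \<mu>" "is_partition (k # \<nu>)" and less: "\<forall>l\<in>set \<mu>. l < k"
  shows "hl_int t 1 X Y (bar_weight N \<mu> (k # \<nu>)) = 0"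
proof -
  have "cnj (hl_int t 1 X Y (bar_weight N \<mu> (k # \<nu>))) = hl_int (cnj t) 1 X Y (bar_weight N (k # \<nu>) \<mu>)"
    using hl_int_cnj[OF t fin, of "bar_weight N \<mu> (k # \<nu>)"] N
    by (simp add: bar_weight_rev length_bar_weight)
  also have "\<dots> = 0" using t fin disj N part less by (intro hl_int_larger_first) auto
  finally show ?thesis by simp
qed

text \<open>If the largest parts of the two partitions agree, the recursion removes them together with one
  variable of each block, in \<open>card X * card Y\<close> ways; otherwise the integral vanishes. If the parts outnumber
  a block, that block becomes empty while parts are left, and the recursion produces an empty sum. If
  no parts are left, the total mass of the weight remains.\<close>
lemma hl_int_value:
  assumes t: "norm t < 1" and fin: "finite X" "finite Y" and disj: "X \<inter> Y = {}"
    and N: "N = card (X \<union> Y)" "length \<mu> + length \<nu> \<le> N"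
    and part: "is_partition \<mu>" "is_partition \<nu>"
  shows "hl_int t 1 X Y (bar_weight N \<mu> \<nu>) =
    (if \<mu> = \<nu> \<and> length \<mu> \<le> card X \<and> length \<mu> \<le> card Y then
       fact (card X) * fact (card Y) * ((1 - t) ^ length \<mu> * mult_fact t \<mu> * qfact t (N - 2 * length \<mu>)) /
         (qfact t (card X - length \<mu>) * qfact t (card Y - length \<mu>))
     else 0)"
  using fin disj N part
proof (induction \<mu> arbitrary: \<nu> X Y N)
  case Nil
  show ?case
  proof (cases \<nu>)
    case Nil
    have "bar_weight N [] [] = replicate N 0" by (simp add: bar_weight_def)
    then show ?thesis
      using hl_int_zero_weight[OF t Nil.prems(1-4)] weight_int_value[OF t Nil.prems(1-3)] Nil
      by (simp add: mult_fact_def)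
  next
    case (Cons l \<nu>')
    then show ?thesis using hl_int_larger_last[OF t, of X Y N "[]" l \<nu>'] Nil.prems by auto
  qed
next
  case (Cons k \<mu>)
  note prems = Cons.prems
  show ?case
  proof (cases \<nu>)
    case Nil
    then show ?thesis using hl_int_larger_first[OF t, of X Y N \<nu> k \<mu>] prems by auto
  next
    case \<nu>: (Cons l \<nu>')
    consider "l < k" | "k < l" | "k = l" by linarith
    then show ?thesis
    proof cases
      case 1
      then have "\<forall>x\<in>set \<nu>. x < k" using prems(7) unfolding \<nu> by (auto simp: is_partition_Cons)
      then show ?thesis
        using hl_int_larger_first[OF t, of X Y N \<nu> k \<mu>] prems 1 \<nu> by auto
    next
      case 2
      then have "\<forall>x\<in>set (k # \<mu>). x < l" using prems(6) by (auto simp: is_partition_Cons)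
      then show ?thesis
        using hl_int_larger_last[OF t, of X Y N "k # \<mu>" l \<nu>'] prems 2 \<nu> by auto
    next
      case 3
      let ?ls = "bar_weight (N - 2) \<mu> \<nu>' @ [- int k]"
      have len: "length \<mu> + length \<nu>' + 2 \<le> N" using prems(5) \<nu> by simp
      have bar: "bar_weight N (k # \<mu>) \<nu> = int k # ?ls"
        unfolding \<nu> using bar_weight_ends[OF len] 3 by simp
      have k: "0 < k" "is_partition \<mu>" "is_partition \<nu>'" "\<forall>x\<in>set \<nu>'. x \<le> k" "\<forall>x\<in>set \<mu>. x \<le> k"
        using prems(6,7) 3 unfolding \<nu> by (auto simp: is_partition_Cons)
      have cardXY: "card (X \<union> Y) = card X + card Y" using prems by (simp add: card_Un_disjoint)
      have sorted: "sorted_wrt (\<ge>) ?ls"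
        using bar_weight_sorted[OF prems(6,7), of N] unfolding bar by simp
      have nonneg: "\<forall>x\<in>set ?ls. 0 \<le> int k + x"
        using k by (auto simp: bar_weight_def split: if_splits)
      have count: "count_list ?ls (last ?ls) = Suc (count_list \<nu>' k)"
        using count_bar_weight_neg[OF k(1)] by simp
      let ?v = "if \<mu> = \<nu>' \<and> length \<mu> \<le> card X - 1 \<and> length \<mu> \<le> card Y - 1 then
         fact (card X - 1) * fact (card Y - 1) * ((1 - t) ^ length \<mu> * mult_fact t \<mu> * qfact t (N - 2 - 2 * length \<mu>)) /
         (qfact t (card X - 1 - length \<mu>) * qfact t (card Y - 1 - length \<mu>)) else 0"
      have sub: "hl_int t 1 (X - {c}) (Y - {a}) (bar_weight (N - 2) \<mu> \<nu>') = ?v" if "a \<in> Y" "c \<in> X" for a c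
      proof -
        have c: "card (X - {c}) = card X - 1" "card (Y - {a}) = card Y - 1" using that prems by auto
        have disj': "(X - {c}) \<inter> (Y - {a}) = {}" using prems(3) by auto
        have "card X > 0" "card Y > 0" using that prems(1,2) by (auto simp: card_gt_0_iff)
        then have "N - 2 = card ((X - {c}) \<union> (Y - {a}))"
          using prems(1,2,4) cardXY c by (simp add: card_Un_disjoint[OF _ _ disj'])
        moreover have "length \<mu> + length \<nu>' \<le> N - 2" using len by simp
        ultimately show ?thesis
          using Cons.IH[of "X - {c}" "Y - {a}" "N - 2" \<nu>', OF _ _ disj'] prems(1,2) k unfolding c by blast
      qed
      have "hl_int t 1 X Y (bar_weight N (k # \<mu>) \<nu>) =
          (1 - t) * qnum t (Suc (count_list \<nu>' k)) *
          (\<Sum>a\<in>Y. \<Sum>c\<in>X. hl_int t 1 (X - {c}) (Y - {a}) (bar_weight (N - 2) \<mu> \<nu>'))"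
      proof -
        have "length ?ls + 1 = card (X \<union> Y)"
          using length_bar_weight[of \<mu> \<nu>' "N - 2"] len prems(4) by simp
        from hl_int_1_recursion[OF t prems(1-3) k(1) this sorted nonneg] show ?thesis
          unfolding bar count by simp
      qed
      also have "\<dots> = (1 - t) * qnum t (Suc (count_list \<nu>' k)) * (of_nat (card X) * of_nat (card Y) * ?v)"
        using sub by simp
      also have "\<dots> = (if k # \<mu> = \<nu> \<and> length (k # \<mu>) \<le> card X \<and> length (k # \<mu>) \<le> card Y then
          fact (card X) * fact (card Y) * ((1 - t) ^ length (k # \<mu>) * mult_fact t (k # \<mu>) * qfact t (N - 2 * length (k # \<mu>))) /
         (qfact t (card X - length (k # \<mu>)) * qfact t (card Y - length (k # \<mu>))) else 0)"
      proof (cases "card X = 0 \<or> card Y = 0")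
        case True
        then show ?thesis by auto
      next
        case False
        then obtain m n where mn: "card X = Suc m" "card Y = Suc n" by (metis not0_implies_Suc)
        show ?thesis
        proof (cases "\<mu> = \<nu>' \<and> length \<mu> \<le> m \<and> length \<mu> \<le> n")
          case True
          have "N - 2 - 2 * length \<mu> = N - 2 * length (k # \<mu>)" by simp
          with True mn show ?thesis unfolding \<nu> using 3 by (simp add: mult_fact_Cons mult_ac)
        next
          case False
          then show ?thesis using mn 3 unfolding \<nu> by auto
        qed
      qed
      finally show ?thesis .
    qed
  qed
qed

section \<open>The vanishing integral\<close>

lemma HL_v_append:
  assumes "set xs \<inter> set ys = {}" shows "HL_v t (xs @ ys) = HL_v t xs * HL_v t ys"
proof -
  have "count_list (xs @ ys) i = count_list xs i" if "i \<in> set xs" for i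
  proof -
    have "i \<notin> set ys" using that assms by blast
    then show ?thesis by simp
  qed
  moreover have "count_list (xs @ ys) i = count_list ys i" if "i \<in> set ys" for i
  proof -
    have "i \<notin> set xs" using that assms by blast
    then show ?thesis by simp
  qed
  ultimately have "(\<Prod>i\<in>set xs. qfact t (count_list (xs @ ys) i)) = HL_v t xs"
    "(\<Prod>i\<in>set ys. qfact t (count_list (xs @ ys) i)) = HL_v t ys"
    unfolding HL_v_def by (simp_all cong: prod.cong)
  then show ?thesis
    using assms by (simp add: HL_v_def prod.union_disjoint)
qed

lemma HL_v_map:
  assumes "inj f" shows "HL_v t (map f \<mu>) = mult_fact t \<mu>"
proof -
  have "count_list (map f \<mu>) (f i) = count_list \<mu> i" for i
    using assms by (induction \<mu>) (auto dest: injD)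
  then show ?thesis
    using assms unfolding HL_v_def mult_fact_def by (simp add: prod.reindex inj_on_subset[of f UNIV])
qed

lemma HL_v_bar_weight:
  assumes "is_partition \<mu>" "is_partition \<nu>"
  shows "HL_v t (bar_weight N \<mu> \<nu>) = mult_fact t \<mu> * qfact t (N - (length \<mu> + length \<nu>)) * mult_fact t \<nu>"
proof -
  let ?n = "N - (length \<mu> + length \<nu>)"
  have rep: "HL_v t (replicate n 0) = qfact t n" for n
    by (cases "n = 0") (simp_all add: HL_v_def set_replicate_conv_if count_list_replicate qfact_def)
  have rev: "HL_v t (rev xs) = HL_v t xs" for xs by (simp add: HL_v_def)
  have pos: "\<forall>k\<in>set \<mu>. 0 < k" "\<forall>k\<in>set \<nu>. 0 < k" using assms by (auto simp: is_partition_def)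
  have "HL_v t (bar_weight N \<mu> \<nu>) = HL_v t (map int \<mu>) * (HL_v t (replicate ?n 0) * HL_v t (rev (map (\<lambda>k. - int k) \<nu>)))"
    unfolding bar_weight_def using pos by (subst HL_v_append, force, subst HL_v_append) force+
  then show ?thesis
    unfolding rev rep by (simp add: HL_v_map inj_def)
qed

lemma HL_integral_eq_hl_int:
  assumes "length \<mu> + length \<nu> \<le> m + n"
  shows "HL_integral t m n \<mu> \<nu> =
    hl_int t 1 {..<m} {m..<m + n} (bar_weight (m + n) \<mu> \<nu>) / (HL_v t (bar_weight (m + n) \<mu> \<nu>) * (fact n * fact m))"
proof -
  let ?l = "bar_weight (m + n) \<mu> \<nu>"
  have un: "{..<m} \<union> {m..<m + n} = {..<m + n}" by auto
  have hl: "hall_littlewood t ?l z = hl_sum t ?l {..<m + n} z / HL_v t ?l" for z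
    using sum_permutes_hl_sum[where ks = ?l and t = t and z = z] length_bar_weight[OF assms] by (simp add: hall_littlewood_def)
  have "HL_integral t m n \<mu> \<nu> = (LINT z|torus {..<m + n}.
      1 / (HL_v t ?l * (fact n * fact m)) *
      (hl_sum t ?l {..<m + n} z * (torus_weight t {..<m} z * torus_weight t {m..<m + n} z)))"
    unfolding HL_integral_def torus_measure_def hl by (simp add: mult_ac)
  also have "\<dots> = 1 / (HL_v t ?l * (fact n * fact m)) * hl_int t 1 {..<m} {m..<m + n} ?l"
    unfolding hl_int_1 un by (rule Bochner_Integration.integral_mult_right_zero)
  finally show ?thesis by simp
qed

text \<open>The \<open>C\<close>-symbol telescopes a quotient of \<open>t\<close>-factorials. For \<open>t = 0\<close> the convention \<open>0 powi k = 0\<close> for negative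
  \<open>k\<close> agrees with the polynomial reading, since \<open>length \<mu> \<le> n\<close>.\<close>
lemma C0_qfact:
  assumes t: "norm t < 1" and l: "length \<mu> \<le> n"
  shows "C0 \<mu> (t ^ n) t * qfact t (n - length \<mu>) = (1 - t) ^ length \<mu> * qfact t n"
proof -
  have t1: "t \<noteq> 1" using t by auto
  have pow: "t powi (1 - int i) * t ^ n = t ^ (n + 1 - i)" if "1 \<le> i" "i \<le> n" for i
  proof (cases "t = 0")
    case False
    then have "t powi (1 - int i) * t powi int n = t powi (1 - int i + int n)"
      by (intro power_int_add[symmetric]) auto
    also have "1 - int i + int n = int (n + 1 - i)" using that by simp
    finally show ?thesis by (simp only: power_int_of_nat)
  next
    case True
    have zero: "(0::complex) ^ n = 0" "(0::complex) ^ (n + 1 - i) = 0" using that by simp_all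
    show ?thesis unfolding True zero by (rule mult_zero_right)
  qed
  have "(\<Prod>i=1..k. 1 - t powi (1 - int i) * t ^ n) * qfact t (n - k) = (1 - t) ^ k * qfact t n" if "k \<le> n" for k
    using that
  proof (induction k)
    case (Suc k)
    have "n - k = Suc (n - Suc k)" using Suc.prems by simp
    then have "qfact t (n - k) = qnum t (n - k) * qfact t (n - Suc k)" by (metis qfact_Suc)
    then have "(1 - t) * qfact t (n - k) = (1 - t ^ (n - k)) * qfact t (n - Suc k)"
      using t1 by (simp add: qnum_def)
    moreover have last: "1 - t powi (1 - int (Suc k)) * t ^ n = 1 - t ^ (n - k)"
      using pow[of "Suc k"] Suc.prems by (simp del: of_nat_Suc)
    moreover have "(\<Prod>i=1..Suc k. f i) = (\<Prod>i=1..k. f i) * f (Suc k)" for f :: "nat \<Rightarrow> complex"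
      by simp
    ultimately have "(\<Prod>i=1..Suc k. 1 - t powi (1 - int i) * t ^ n) * qfact t (n - Suc k) =
        (\<Prod>i=1..k. 1 - t powi (1 - int i) * t ^ n) * ((1 - t) * qfact t (n - k))"
      by (simp only: mult.assoc)
    also have "\<dots> = (1 - t) ^ Suc k * qfact t n" using Suc by (simp add: mult_ac)
    finally show ?case .
  qed simp
  from this[OF l] show ?thesis unfolding C0_def .
qed

theorem theorem8p1:
  fixes t :: complex and m n :: nat and \<mu> \<nu> :: "nat list"
  assumes "norm t < 1"
    and "m \<le> n"
    and "is_partition \<mu>" and "is_partition \<nu>"
    and "length \<mu> + length \<nu> \<le> n + m"
  shows "1 / HL_integral t m n [] [] * HL_integral t m n \<mu> \<nu> =
    (if \<mu> = \<nu> \<and> length \<mu> \<le> m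
     then C0_pair \<mu> (t ^ n) (t ^ m) t /
          (Cminus \<mu> t * Cplus \<mu> (t powi (int m + int n - 2) * t) t)
     else 0)"
proof -
  note t = assms(1)
  let ?X = "{..<m}" and ?Y = "{m..<m + n}" and ?l = "length \<mu>"
  let ?q = "qfact t"
  have XY: "finite ?X" "finite ?Y" "?X \<inter> ?Y = {}" "m + n = card (?X \<union> ?Y)" "card ?X = m" "card ?Y = n"
    by (auto simp: ivl_disj_un)
  have nz: "?q i \<noteq> 0" "mult_fact t \<mu> \<noteq> 0" for i
    using qfact_nonzero[OF t] mult_fact_nonzero[OF t] by auto
  have t1: "t \<noteq> 1" using t by auto
  have nil: "is_partition []" by (simp add: is_partition_def)
  have Z: "HL_integral t m n [] [] = 1 / (?q m * ?q n)"
    using HL_integral_eq_hl_int[of "[]" "[]" m n t] hl_int_value[OF t XY(1-4) _ nil nil] HL_v_bar_weight[OF nil nil, of t "m + n"]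
      nz XY(5,6) by (simp add: mult_fact_def)
  have len: "length \<mu> + length \<nu> \<le> m + n" using assms(5) by simp
  note I = HL_integral_eq_hl_int[OF len, of t] hl_int_value[OF t XY(1-4) len assms(3,4)]
    HL_v_bar_weight[OF assms(3,4), of t "m + n"]
  show ?thesis
  proof (cases "\<mu> = \<nu> \<and> ?l \<le> m")
    case False
    then have "HL_integral t m n \<mu> \<nu> = 0" using I(1,2) XY(5) by auto
    then show ?thesis using False by auto
  next
    case True
    then have ln: "?l \<le> m" "?l \<le> n" using assms(2) by auto
    let ?c = "mult_fact t \<mu>"
    have "HL_integral t m n \<mu> \<nu> = (1 - t) ^ ?l / (?c * (?q (m - ?l) * ?q (n - ?l)))"
    proof -
      have "HL_v t (bar_weight (m + n) \<mu> \<nu>) = ?c * ?q (m + n - 2 * ?l) * ?c"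
        using I(3) True by (simp add: mult_2)
      moreover have "hl_int t 1 ?X ?Y (bar_weight (m + n) \<mu> \<nu>) =
          fact m * fact n * ((1 - t) ^ ?l * ?c * ?q (m + n - 2 * ?l)) / (?q (m - ?l) * ?q (n - ?l))"
        using I(2) True ln XY(5,6) by simp
      ultimately show ?thesis unfolding I(1) using nz by (simp add: field_simps)
    qed
    then have "1 / HL_integral t m n [] [] * HL_integral t m n \<mu> \<nu> =
        ?q m * ?q n * (1 - t) ^ ?l / (?c * (?q (m - ?l) * ?q (n - ?l)))"
      unfolding Z by simp
    also have "\<dots> = (C0 \<mu> (t ^ n) t * C0 \<mu> (t ^ m) t) / ((1 - t) ^ ?l * ?c)"
    proof -
      have "C0 \<mu> (t ^ n) t = (1 - t) ^ ?l * ?q n / ?q (n - ?l)" "C0 \<mu> (t ^ m) t = (1 - t) ^ ?l * ?q m / ?q (m - ?l)"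
        using C0_qfact[OF t ln(2)] C0_qfact[OF t ln(1)] nz by (simp_all add: eq_divide_eq)
      then show ?thesis using nz t1 by (simp add: field_simps)
    qed
    also have "\<dots> = C0_pair \<mu> (t ^ n) (t ^ m) t / (Cminus \<mu> t * Cplus \<mu> (t powi (int m + int n - 2) * t) t)"
      by (simp add: C0_pair_def Cminus_def Cplus_def mult_fact_def)
    finally show ?thesis by (simp only: if_P[OF True])
  qed
qed

end
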